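(* Let $(T(t))_{t\ge 0}$ be a bounded $C_0$-semigroup on a Hilbert space $X$, with generator $-A$. Assume that $\sigma(A)\cap i\mathbb{R}$ is empty, and that $$\|(is+A)^{-1}\|=O\left(\frac{|s|^{\alpha}}{\ell(|s|)}\right),\qquad |s|\to\infty,$$ where $\alpha>0$ and $\ell$ is increasing, slowly varying and dB-symmetric. Then $$\|T(t)A^{-1}\|=O\left(\frac{1}{M^{-1}(t)}\right),\qquad t\to\infty,$$ where $M^{-1}$ is any asymptotic inverse of the function $s\mapsto s^{\alpha}/\ell(s)$.
   Context: For positive functions defined near infinity, $f(s)\sim g(s)$ means $\lim_{s\to\infty}f(s)/g(s)=1$. A strictly positive measurable function $\ell$ on $[a,\infty)$ (for some $a$) is slowly varying if $\ell(\lambda s)\sim\ell(s)$ for every $\lambda>0$. "Increasing" means non-decreasing. A monotonic slowly varying function $\ell$ is dB-symmetric if $\ell(s\ell(s))\sim\ell(s)$ (equivalently, $\ell(s/\ell(s))\sim\ell(s)$). An asymptotic inverse of a function $M$ is a positive function $M^{-1}$, defined on some interval $[b,\infty)$, such that $M^{-1}(M(s))\sim s$ and $M(M^{-1}(s))\sim s$ as $s\to\infty$. *)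

theory Defs
  imports "HOL-Analysis.Analysis" "HOL-Library.Landau_Symbols"
begin

unbundle asymp_equiv_syntax

text \<open>
  The distribution only has real inner product spaces. The class below adds a complex
  scalar multiplication and an inner product, linear in the first argument, to a real normed
  space; the last axiom says that the norm is the one induced by the inner product, and
  together with the norm axioms it gives positive definiteness.
\<close>

class complex_inner = real_normed_vector +
  fixes scaleC :: "complex \<Rightarrow> 'a \<Rightarrow> 'a" (infixr \<open>*\<^sub>C\<close> 75)
    and cinner :: "'a \<Rightarrow> 'a \<Rightarrow> complex"
  assumes scaleC_add_right: "a *\<^sub>C (x + y) = a *\<^sub>C x + a *\<^sub>C y"
    and scaleC_add_left: "(a + b) *\<^sub>C x = a *\<^sub>C x + b *\<^sub>C x"
    and scaleC_scaleC: "a *\<^sub>C b *\<^sub>C x = (a * b) *\<^sub>C x"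
    and scaleR_scaleC: "r *\<^sub>R x = complex_of_real r *\<^sub>C x"
    and cinner_commute: "cinner x y = cnj (cinner y x)"
    and cinner_add_left: "cinner (x + y) z = cinner x z + cinner y z"
    and cinner_scaleC_left: "cinner (a *\<^sub>C x) y = a * cinner x y"
    and cinner_self: "cinner x x = complex_of_real ((norm x)\<^sup>2)"

class complex_hilbert = complex_inner + complete_space

instantiation complex :: complex_hilbert
begin

definition scaleC_complex :: "complex \<Rightarrow> complex \<Rightarrow> complex" where
  "scaleC_complex a x = a * x"

definition cinner_complex :: "complex \<Rightarrow> complex \<Rightarrow> complex" where
  "cinner_complex x y = x * cnj y"

instance
  by standard
    (auto simp: scaleC_complex_def cinner_complex_def algebra_simps scaleR_conv_of_real
      simp flip: complex_norm_square)

end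

definition bounded_clinear :: "('a::complex_inner \<Rightarrow> 'b::complex_inner) \<Rightarrow> bool" where
  "bounded_clinear f \<longleftrightarrow> bounded_linear f \<and> (\<forall>c x. f (c *\<^sub>C x) = c *\<^sub>C f x)"

text \<open>Only the values \<open>T t\<close> with \<open>t \<ge> 0\<close> are constrained.\<close>

definition C0_semigroup :: "(real \<Rightarrow> 'a::complex_hilbert \<Rightarrow> 'a) \<Rightarrow> bool" where
  "C0_semigroup T \<longleftrightarrow>
     (\<forall>t\<ge>0. bounded_clinear (T t)) \<and>
     T 0 = id \<and>
     (\<forall>s\<ge>0. \<forall>t\<ge>0. T (s + t) = T s \<circ> T t) \<and>
     (\<forall>x. ((\<lambda>t. T t x) \<longlongrightarrow> x) (at_right 0))"

definition bounded_C0_semigroup :: "(real \<Rightarrow> 'a::complex_hilbert \<Rightarrow> 'a) \<Rightarrow> bool" where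
  "bounded_C0_semigroup T \<longleftrightarrow> C0_semigroup T \<and> (\<exists>K. \<forall>t\<ge>0. onorm (T t) \<le> K)"

text \<open>
  An unbounded operator is given by its domain \<open>D\<close> and a function of which only the values
  on \<open>D\<close> matter.
\<close>

definition is_generator ::
    "(real \<Rightarrow> 'a::complex_hilbert \<Rightarrow> 'a) \<Rightarrow> 'a set \<Rightarrow> ('a \<Rightarrow> 'a) \<Rightarrow> bool" where
  "is_generator T D G \<longleftrightarrow>
     D = {x. \<exists>y. ((\<lambda>h. (T h x - x) /\<^sub>R h) \<longlongrightarrow> y) (at_right 0)} \<and>
     (\<forall>x\<in>D. ((\<lambda>h. (T h x - x) /\<^sub>R h) \<longlongrightarrow> G x) (at_right 0))"

definition resolvent_set :: "'a::complex_hilbert set \<Rightarrow> ('a \<Rightarrow> 'a) \<Rightarrow> complex set" where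
  "resolvent_set D A =
     {z. bij_betw (\<lambda>x. z *\<^sub>C x - A x) D UNIV \<and>
         bounded_clinear (inv_into D (\<lambda>x. z *\<^sub>C x - A x))}"

definition spectrum :: "'a::complex_hilbert set \<Rightarrow> ('a \<Rightarrow> 'a) \<Rightarrow> complex set" where
  "spectrum D A = - resolvent_set D A"

text \<open>
  A function on \<open>[a, \<infinity>)\<close> is represented by a total function whose values below \<open>a\<close> are
  irrelevant.
\<close>

definition slowly_varying_on :: "real \<Rightarrow> (real \<Rightarrow> real) \<Rightarrow> bool" where
  "slowly_varying_on a l \<longleftrightarrow>
     (\<forall>s\<ge>a. l s > 0) \<and>
     l \<in> borel_measurable (lebesgue_on {a..}) \<and>
     (\<forall>c>0. (\<lambda>s. l (c * s)) \<sim>[at_top] l)"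

definition dB_symmetric_on :: "real \<Rightarrow> (real \<Rightarrow> real) \<Rightarrow> bool" where
  "dB_symmetric_on a l \<longleftrightarrow>
     slowly_varying_on a l \<and>
     (mono_on {a..} l \<or> antimono_on {a..} l) \<and>
     (\<lambda>s. l (s * l s)) \<sim>[at_top] l"

text \<open>
  \<open>N\<close>, defined on \<open>[b, \<infinity>)\<close>, is an asymptotic inverse of \<open>M\<close>, defined on \<open>[a, \<infinity>)\<close>. The
  second and third conjuncts say that the compositions in the last two are
  defined near infinity, so that no values outside these intervals enter.
\<close>

definition asymptotic_inverse_on ::
    "real \<Rightarrow> (real \<Rightarrow> real) \<Rightarrow> real \<Rightarrow> (real \<Rightarrow> real) \<Rightarrow> bool" where
  "asymptotic_inverse_on a M b N \<longleftrightarrow>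
     (\<forall>s\<ge>b. N s > 0) \<and>
     (\<forall>\<^sub>F s in at_top. M s \<ge> b) \<and>
     (\<forall>\<^sub>F s in at_top. N s \<ge> a) \<and>
     (\<lambda>s. N (M s)) \<sim>[at_top] (\<lambda>s. s) \<and>
     (\<lambda>s. M (N s)) \<sim>[at_top] (\<lambda>s. s)"

end

theory Submission
  imports Defs
begin

text \<open>
  A component of frequency \<open>s\<close> decays like \<open>exp (- t / M s)\<close>, where \<open>M s = s\<^sup>\<alpha> / l s\<close> is the size of the
  resolvent at \<open>i s\<close>, and \<open>A\<inverse>\<close> damps it by \<open>1 / s\<close>. At time \<open>t\<close> the critical frequency is
  therefore \<open>\<rho> = M\<inverse> t\<close>: higher frequencies are of size at most \<open>1 / \<rho>\<close> because of \<open>A\<inverse>\<close> alone, and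
  lower ones have decayed enough.

  To make this rigorous, let \<open>J = \<rho> (\<rho> + A)\<inverse>\<close>, which cuts off the frequencies above \<open>\<rho>\<close>, and
  \<open>L = A\<inverse> J\<^sup>q\<close>. The difference \<open>A\<inverse> - L\<close> has norm of order \<open>1 / \<rho>\<close> (\<open>high_frequency_part\<close>), so it
  remains to bound \<open>T t L\<close>. The growth properties of \<open>M\<close>, namely \<open>M s \<le> C (s / \<rho>)\<^bsup>\<alpha>/2\<^esup> M \<rho>\<close> for \<open>s \<le> \<rho>\<close>, which
  is Potter's bound for \<open>l\<close>, and \<open>M s \<le> (s / \<rho>)\<^sup>\<alpha> M \<rho>\<close> for \<open>s \<ge> \<rho>\<close>, which is monotonicity of \<open>l\<close> (both for large \<open>s\<close> and \<open>\<rho>\<close>), give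
  \<open>\<parallel>(i s + A)\<^bsup>-n\<^esup> L\<parallel> \<le> C (M \<rho>)\<^sup>n / \<rho>\<close> for all real \<open>s\<close>, provided that \<open>n\<close> and \<open>q\<close> are large
  (\<open>smoothed_resolvent_bound\<close>). A uniform bound \<open>\<parallel>(i s + A)\<^bsup>-n\<^esup> L\<parallel> \<le> N\<close> implies
  \<open>\<parallel>T t L\<parallel> \<le> C N / t\<^sup>n\<close> on a Hilbert space, and with \<open>M \<rho> \<le> 2 t\<close> the result is a multiple
  of \<open>1 / \<rho>\<close>.

  The last implication rests on Plancherel's theorem: \<open>t\<^sup>n T t L x\<close> is, up to a constant, the inverse
  Fourier transform of \<open>(z + A)\<^bsup>-n\<^esup> L\<close> applied to the transform of \<open>T t x\<close>. The argument is carried out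
  in discrete time. The semigroup is replaced by powers of the implicit Euler step
  \<open>V = \<mu> (\<mu> + A)\<inverse>\<close>. The operators \<open>V (1 - \<zeta> V)\<inverse>\<close> are exactly multiples of resolvents of \<open>-A\<close> in the
  right half-plane, and the Fourier transform becomes a power series on a circle, for which Plancherel's
  theorem follows from the finite Parseval identity over roots of unity (\<open>Plancherel_multiplier\<close>,
  \<open>J_power_decay\<close>). The bounds do not depend on the step length, and \<open>exponential_formula\<close> recovers
  the semigroup in the limit.

  The resolvents in the right half-plane are obtained without vector-valued integration, by
  continuation from the imaginary axis along horizontal lines (\<open>half_plane_bij\<close>).
\<close>

section \<open>Complex inner product spaces and the finite Fourier transform\<close>

lemma scaleC_zero_left [simp]: "0 *\<^sub>C (x::'a::complex_inner) = 0"
  using scaleR_scaleC[of 0 x] by simp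

lemma scaleC_one [simp]: "1 *\<^sub>C (x::'a::complex_inner) = x"
  using scaleR_scaleC[of 1 x] by simp

lemma scaleC_minus_right [simp]: "c *\<^sub>C (- x) = - (c *\<^sub>C (x::'a::complex_inner))"
  using scaleC_add_right[of c x "- x"] scaleC_add_right[of c 0 "0::'a"]
  by (simp add: eq_neg_iff_add_eq_0 add.commute)

lemma scaleC_minus_left [simp]: "(- c) *\<^sub>C x = - (c *\<^sub>C (x::'a::complex_inner))"
  using scaleC_add_left[of c "- c" x] by (simp add: eq_neg_iff_add_eq_0 add.commute)

lemma scaleC_diff_right: "c *\<^sub>C (x - y) = c *\<^sub>C x - c *\<^sub>C (y::'a::complex_inner)"
  using scaleC_add_right[of c x "- y"] by simp

lemma scaleC_diff_left: "(c - d) *\<^sub>C x = c *\<^sub>C x - d *\<^sub>C (x::'a::complex_inner)"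
  using scaleC_add_left[of c "- d" x] by simp

lemma scaleC_left_commute: "c *\<^sub>C d *\<^sub>C x = d *\<^sub>C c *\<^sub>C (x::'a::complex_inner)"
  by (simp add: scaleC_scaleC mult.commute)

lemma norm_scaleC: "norm (c *\<^sub>C x) = cmod c * norm (x::'a::complex_inner)"
proof -
  have "complex_of_real ((norm (c *\<^sub>C x))\<^sup>2) = c * cnj c * complex_of_real ((norm x)\<^sup>2)"
    by (metis cinner_self cinner_scaleC_left cinner_commute complex_cnj_mult mult.assoc)
  also have "\<dots> = complex_of_real ((cmod c * norm x)\<^sup>2)"
    by (simp only: of_real_mult power_mult_distrib complex_norm_square)
  finally have "(norm (c *\<^sub>C x))\<^sup>2 = (cmod c * norm x)\<^sup>2"
    using of_real_eq_iff by blast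
  then show ?thesis by (simp add: power2_eq_iff_nonneg)
qed

lemma bounded_linear_scaleC: "bounded_linear (\<lambda>x::'a::complex_inner. c *\<^sub>C x)"
proof (rule bounded_linear_intro)
  show "c *\<^sub>C (r *\<^sub>R x) = r *\<^sub>R c *\<^sub>C x" for r and x :: 'a
    by (simp add: scaleR_scaleC scaleC_left_commute)
  show "norm (c *\<^sub>C x) \<le> norm x * cmod c" for x :: 'a
    by (simp add: norm_scaleC mult.commute)
qed (simp add: scaleC_add_right)

lemma cinner_sum_left: "cinner (\<Sum>i\<in>I. f i) z = (\<Sum>i\<in>I. cinner (f i) z)"
proof -
  have "cinner 0 z = 0" using cinner_add_left[of 0 0 z] by simp
  then show ?thesis
    by (induction I rule: infinite_finite_induct) (auto simp: cinner_add_left)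
qed

lemma cinner_sum_right: "cinner z (\<Sum>i\<in>I. f i) = (\<Sum>i\<in>I. cinner z (f i))"
  by (subst (1 2) cinner_commute) (simp add: cinner_sum_left flip: cinner_commute)

lemma cinner_scaleC_right: "cinner x (c *\<^sub>C y) = cnj c * cinner x y"
  by (metis cinner_commute cinner_scaleC_left complex_cnj_mult)

text \<open>Orthogonality of the characters of the cyclic group of order \<open>P\<close>: for \<open>k \<noteq> l\<close> the sum is a
  geometric one whose ratio is a \<open>P\<close>-th root of unity different from \<open>1\<close>.\<close>

lemma sum_roots_of_unity_orthogonal:
  fixes P k l :: nat
  assumes "k < P" "l < P"
  defines "\<omega> \<equiv> \<lambda>j. cis (2 * pi * real j / real P)"
  shows "(\<Sum>j<P. \<omega> j ^ k * cnj (\<omega> j ^ l)) = (if k = l then of_nat P else 0)"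
proof -
  let ?d = "cis (2 * pi * (real k - real l) / real P)"
  have pow: "\<omega> j ^ k * cnj (\<omega> j ^ l) = ?d ^ j" for j
    by (simp add: \<omega>_def Complex.DeMoivre cis_cnj cis_mult right_diff_distrib diff_divide_distrib mult_ac)
  show ?thesis
  proof (cases "k = l")
    case True
    then show ?thesis unfolding pow by simp
  next
    case False
    have "?d \<noteq> 1"
    proof
      assume "?d = 1"
      then have "cos (2 * pi * (real k - real l) / real P) = 1"
        by (simp add: complex_eq_iff)
      then obtain n :: int where n: "2 * pi * (real k - real l) / real P = of_int n * 2 * pi"
        using cos_one_2pi_int by auto
      then have "2 * pi * ((real k - real l) / real P) = 2 * pi * of_int n"
        by simp
      then have "(real k - real l) / real P = of_int n"
        by (subst (asm) mult_cancel_left) simp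
      then have "real k - real l = of_int n * real P"
        using assms by (simp add: field_simps)
      then have *: "int k - int l = n * int P"
        by (metis (mono_tags, opaque_lifting) of_int_diff of_int_eq_iff of_int_mult of_int_of_nat_eq)
      then have "\<bar>n * int P\<bar> < int P" using assms by linarith
      then have "\<bar>n\<bar> < 1" using assms by (simp add: abs_mult)
      then show False using * False by simp
    qed
    moreover have "?d ^ P = 1"
    proof -
      have "?d ^ P = cis (2 * pi * of_int (int k - int l))"
        using assms by (simp add: Complex.DeMoivre)
      then show ?thesis by (simp only: cis_multiple_2pi Ints_of_int)
    qed
    ultimately have "(\<Sum>j<P. ?d ^ j) = 0"
      by (simp add: sum_gp_strict)
    then show ?thesis unfolding pow using False by simp
  qed
qed

text \<open>The place where the inner product enters: expanding the squared norms leaves only the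
  diagonal terms.\<close>

lemma finite_Parseval:
  fixes a :: "nat \<Rightarrow> 'a::complex_inner"
  defines "\<omega> \<equiv> \<lambda>P j. cis (2 * pi * real j / real P)"
  shows "(\<Sum>j<P. (norm (\<Sum>k<P. \<omega> P j ^ k *\<^sub>C a k))\<^sup>2) = real P * (\<Sum>k<P. (norm (a k))\<^sup>2)"
proof -
  have "complex_of_real (\<Sum>j<P. (norm (\<Sum>k<P. \<omega> P j ^ k *\<^sub>C a k))\<^sup>2)
      = (\<Sum>j<P. cinner (\<Sum>k<P. \<omega> P j ^ k *\<^sub>C a k) (\<Sum>k<P. \<omega> P j ^ k *\<^sub>C a k))"
    by (simp add: cinner_self)
  also have "\<dots> = (\<Sum>j<P. \<Sum>l<P. \<Sum>k<P. \<omega> P j ^ k * cnj (\<omega> P j ^ l) * cinner (a k) (a l))"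
    by (simp add: cinner_sum_left cinner_sum_right cinner_scaleC_left cinner_scaleC_right
        sum_distrib_left mult_ac)
  also have "\<dots> = (\<Sum>l<P. \<Sum>k<P. \<Sum>j<P. \<omega> P j ^ k * cnj (\<omega> P j ^ l) * cinner (a k) (a l))"
    by (subst sum.swap, rule sum.cong[OF refl], rule sum.swap)
  also have "\<dots> = (\<Sum>l<P. \<Sum>k<P. (\<Sum>j<P. \<omega> P j ^ k * cnj (\<omega> P j ^ l)) * cinner (a k) (a l))"
    by (simp only: sum_distrib_right)
  also have "\<dots> = (\<Sum>l<P. \<Sum>k<P. (if k = l then of_nat P * cinner (a k) (a l) else 0))"
    unfolding \<omega>_def
    by (intro sum.cong refl) (subst sum_roots_of_unity_orthogonal, auto)
  also have "\<dots> = complex_of_real (real P * (\<Sum>k<P. (norm (a k))\<^sup>2))"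
    by (simp add: cinner_self sum_distrib_left)
  finally show ?thesis using of_real_eq_iff by blast
qed

instance complex_hilbert \<subseteq> banach ..

lemma summable_scaleC_unit:
  fixes a :: "nat \<Rightarrow> 'a::complex_hilbert"
  assumes "summable (\<lambda>k. norm (a k))" "cmod \<omega> = 1"
  shows "summable (\<lambda>k. \<omega> ^ k *\<^sub>C a k)"
  by (rule summable_norm_cancel) (use assms in \<open>simp add: norm_scaleC norm_power\<close>)

text \<open>This is the multiplier form of Plancherel's theorem on the circle: a pointwise bound between
  two Fourier series gives the same bound between the \<open>\<ell>\<^sup>2\<close> norms of their coefficients. Truncate both series at \<open>p\<close>, apply the finite Parseval identity
  with \<open>P = p\<close>, and let \<open>p\<close> tend to infinity; the errors \<open>\<epsilon> p\<close> are tails of convergent series.\<close>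

lemma Plancherel_multiplier:
  fixes a b :: "nat \<Rightarrow> 'a::complex_hilbert"
  assumes a: "summable (\<lambda>k. norm (a k))" and b: "summable (\<lambda>k. norm (b k))"
    and B: "B \<ge> 0"
    and le: "\<And>\<omega>. cmod \<omega> = 1 \<Longrightarrow> norm (\<Sum>k. \<omega> ^ k *\<^sub>C b k) \<le> B * norm (\<Sum>k. \<omega> ^ k *\<^sub>C a k)"
    and q: "summable (\<lambda>k. (norm (a k))\<^sup>2)"
  shows "(\<Sum>k<m. (norm (b k))\<^sup>2) \<le> B\<^sup>2 * (\<Sum>k. (norm (a k))\<^sup>2)"
proof -
  define \<epsilon> where "\<epsilon> p = (\<Sum>k. norm (b (k + p))) + B * (\<Sum>k. norm (a (k + p)))" for p
  define S where "S = (\<Sum>k. (norm (a k))\<^sup>2)"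
  have tail: "norm ((\<Sum>k. \<omega> ^ k *\<^sub>C c k) - (\<Sum>k<p. \<omega> ^ k *\<^sub>C c k)) \<le> (\<Sum>k. norm (c (k + p)))"
    if "summable (\<lambda>k. norm (c k))" "cmod \<omega> = 1" for c :: "nat \<Rightarrow> 'a" and \<omega> p
  proof -
    have "(\<Sum>k. \<omega> ^ k *\<^sub>C c k) - (\<Sum>k<p. \<omega> ^ k *\<^sub>C c k) = (\<Sum>k. \<omega> ^ (k + p) *\<^sub>C c (k + p))"
      using suminf_minus_initial_segment[OF summable_scaleC_unit[OF that], of p] by simp
    also have "norm \<dots> \<le> (\<Sum>k. norm (\<omega> ^ (k + p) *\<^sub>C c (k + p)))"
      by (rule summable_norm)
        (use that summable_ignore_initial_segment[OF that(1), of p] in \<open>simp add: norm_scaleC norm_mult norm_power\<close>)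
    finally show ?thesis using that by (simp add: norm_scaleC norm_mult norm_power)
  qed
  have fin: "sqrt (\<Sum>k<p. (norm (b k))\<^sup>2) \<le> B * sqrt S + \<epsilon> p" if "p > 0" for p
  proof -
    define \<omega> where "\<omega> j = cis (2 * pi * real j / real p)" for j
    define u where "u j = norm (\<Sum>k<p. \<omega> j ^ k *\<^sub>C b k)" for j
    define v where "v j = norm (\<Sum>k<p. \<omega> j ^ k *\<^sub>C a k)" for j
    have \<omega>: "cmod (\<omega> j) = 1" for j by (simp add: \<omega>_def)
    have \<epsilon>0: "\<epsilon> p \<ge> 0"
      unfolding \<epsilon>_def
      using B summable_ignore_initial_segment[OF a, of p] summable_ignore_initial_segment[OF b, of p]
      by (intro add_nonneg_nonneg mult_nonneg_nonneg suminf_nonneg) auto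
    have uv: "u j \<le> B * v j + \<epsilon> p" for j
    proof -
      have "u j \<le> norm (\<Sum>k. \<omega> j ^ k *\<^sub>C b k) + (\<Sum>k. norm (b (k + p)))"
        using tail[OF b \<omega>, of j p] unfolding u_def by norm
      moreover have "norm (\<Sum>k. \<omega> j ^ k *\<^sub>C a k) \<le> v j + (\<Sum>k. norm (a (k + p)))"
        using tail[OF a \<omega>, of j p] unfolding v_def by norm
      then have "B * norm (\<Sum>k. \<omega> j ^ k *\<^sub>C a k) \<le> B * (v j + (\<Sum>k. norm (a (k + p))))"
        using B by (rule mult_left_mono)
      ultimately show ?thesis using le[OF \<omega>, of j] unfolding \<epsilon>_def by (simp add: algebra_simps)
    qed
    have "L2_set u {..<p} \<le> L2_set (\<lambda>j. B * v j + \<epsilon> p) {..<p}"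
      by (rule L2_set_mono) (use uv in \<open>auto simp: u_def\<close>)
    also have "\<dots> \<le> L2_set (\<lambda>j. B * v j) {..<p} + L2_set (\<lambda>j. \<epsilon> p) {..<p}"
      by (rule L2_set_triangle_ineq)
    also have "\<dots> = B * L2_set v {..<p} + sqrt (real p) * \<epsilon> p"
      using \<epsilon>0 by (simp add: L2_set_right_distrib[OF B]) (simp add: L2_set_def real_sqrt_mult)
    also have "L2_set v {..<p} = sqrt (real p) * sqrt (\<Sum>k<p. (norm (a k))\<^sup>2)"
      using finite_Parseval[of p a] by (simp add: L2_set_def v_def \<omega>_def real_sqrt_mult)
    also have "L2_set u {..<p} = sqrt (real p) * sqrt (\<Sum>k<p. (norm (b k))\<^sup>2)"
      using finite_Parseval[of p b] by (simp add: L2_set_def u_def \<omega>_def real_sqrt_mult)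
    finally have "sqrt (real p) * sqrt (\<Sum>k<p. (norm (b k))\<^sup>2)
        \<le> sqrt (real p) * (B * sqrt (\<Sum>k<p. (norm (a k))\<^sup>2) + \<epsilon> p)"
      by (simp add: algebra_simps)
    then have "sqrt (\<Sum>k<p. (norm (b k))\<^sup>2) \<le> B * sqrt (\<Sum>k<p. (norm (a k))\<^sup>2) + \<epsilon> p"
      using that by simp
    also have "(\<Sum>k<p. (norm (a k))\<^sup>2) \<le> S"
      unfolding S_def by (rule sum_le_suminf[OF q]) auto
    finally show ?thesis using B by (simp add: mult_left_mono)
  qed
  \<comment> \<open>The left-hand side of \<open>fin\<close> grows with \<open>p\<close>, while the error on the right vanishes.\<close>
  have "(\<lambda>p. B * sqrt S + \<epsilon> p) \<longlonglongrightarrow> B * sqrt S + (0 + B * 0)"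
    unfolding \<epsilon>_def by (intro tendsto_intros suminf_exist_split2 a b)
  moreover have "\<forall>\<^sub>F p in sequentially. sqrt (\<Sum>k<m. (norm (b k))\<^sup>2) \<le> B * sqrt S + \<epsilon> p"
    using eventually_ge_at_top[of "max 1 m"]
  proof eventually_elim
    case (elim p)
    have "(\<Sum>k<m. (norm (b k))\<^sup>2) \<le> (\<Sum>k<p. (norm (b k))\<^sup>2)"
      using elim by (intro sum_mono2) auto
    then show ?case using fin[of p] elim
      by (smt (verit) max.bounded_iff real_sqrt_le_mono zero_less_one less_le_trans)
  qed
  ultimately have "sqrt (\<Sum>k<m. (norm (b k))\<^sup>2) \<le> B * sqrt S + (0 + B * 0)"
    by (rule tendsto_lowerbound) auto
  then have "(sqrt (\<Sum>k<m. (norm (b k))\<^sup>2))\<^sup>2 \<le> (B * sqrt S)\<^sup>2"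
    by (intro power_mono) (auto intro: sum_nonneg)
  moreover have "S \<ge> 0" unfolding S_def using q by (intro suminf_nonneg) auto
  ultimately show ?thesis by (simp add: S_def power_mult_distrib sum_nonneg)
qed

section \<open>The resolvent on the closed right half-plane\<close>

text \<open>The assumptions on the imaginary axis are phrased with \<open>z + A\<close>, the resolvents of the generator \<open>-A\<close>.
  The two assumptions \<open>K \<ge> 1\<close> and \<open>T_bound\<close> hold for any larger \<open>K\<close>, so the first is a
  normalisation.\<close>

locale bounded_semigroup =
  fixes T :: "real \<Rightarrow> 'a::complex_hilbert \<Rightarrow> 'a" and D :: "'a set" and A :: "'a \<Rightarrow> 'a" and K :: real
  assumes T_clinear: "t \<ge> 0 \<Longrightarrow> bounded_clinear (T t)"
    and T_0: "T 0 = id"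
    and T_add: "s \<ge> 0 \<Longrightarrow> t \<ge> 0 \<Longrightarrow> T (s + t) = T s \<circ> T t"
    and T_bound: "t \<ge> 0 \<Longrightarrow> norm (T t x) \<le> K * norm x"
    and K_ge_1: "K \<ge> 1"
    and gen: "is_generator T D (\<lambda>x. - A x)"
    and imag_bij: "bij_betw (\<lambda>x. (\<i> * complex_of_real s) *\<^sub>C x + A x) D UNIV"
    and imag_bounded: "\<exists>B. \<forall>y. norm (inv_into D (\<lambda>x. (\<i> * complex_of_real s) *\<^sub>C x + A x) y) \<le> B * norm y"
begin

lemma T_linear: "t \<ge> 0 \<Longrightarrow> bounded_linear (T t)"
  using T_clinear by (simp add: bounded_clinear_def)

lemma T_scaleC: "t \<ge> 0 \<Longrightarrow> T t (c *\<^sub>C x) = c *\<^sub>C T t x"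
  using T_clinear by (simp add: bounded_clinear_def)

lemmas T_plus = linear_add[OF bounded_linear.linear[OF T_linear]]
lemmas T_diff = linear_diff[OF bounded_linear.linear[OF T_linear]]
lemmas T_scaleR = linear_scale[OF bounded_linear.linear[OF T_linear]]

lemma T_commute: "s \<ge> 0 \<Longrightarrow> t \<ge> 0 \<Longrightarrow> T s (T t x) = T t (T s x)"
  using T_add[of s t] T_add[of t s] by (simp add: add.commute fun_eq_iff)

lemma generator_tendsto:
  "x \<in> D \<Longrightarrow> ((\<lambda>h. (T h x - x) /\<^sub>R h) \<longlongrightarrow> - A x) (at_right 0)"
  using gen by (simp add: is_generator_def)

lemma generatorI:
  assumes "((\<lambda>h. (T h x - x) /\<^sub>R h) \<longlongrightarrow> - y) (at_right 0)"
  shows "x \<in> D" "A x = y"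
proof -
  show D: "x \<in> D" using gen assms unfolding is_generator_def by blast
  show "A x = y"
    using tendsto_unique[OF _ generator_tendsto[OF D] assms] by simp
qed

lemma eventually_pos_at_right: "\<forall>\<^sub>F h in at_right (0::real). h > 0"
  by (simp add: eventually_at_right_less)

lemma
  assumes "x \<in> D" "y \<in> D"
  shows D_add: "x + y \<in> D" and A_add: "A (x + y) = A x + A y"
proof -
  have "((\<lambda>h. (T h x - x) /\<^sub>R h + (T h y - y) /\<^sub>R h) \<longlongrightarrow> - A x + - A y) (at_right 0)"
    by (intro tendsto_add generator_tendsto assms)
  moreover have "\<forall>\<^sub>F h in at_right 0. (T h x - x) /\<^sub>R h + (T h y - y) /\<^sub>R h = (T h (x + y) - (x + y)) /\<^sub>R h"
    using eventually_pos_at_right by eventually_elim (simp add: T_plus algebra_simps)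
  ultimately have "((\<lambda>h. (T h (x + y) - (x + y)) /\<^sub>R h) \<longlongrightarrow> - (A x + A y)) (at_right 0)"
    by (simp add: tendsto_cong)
  from generatorI[OF this] show "x + y \<in> D" "A (x + y) = A x + A y" by auto
qed

text \<open>A bounded operator that commutes with the semigroup can be pulled out of the difference
  quotient, so it preserves the domain and commutes with \<open>A\<close>. The instances are scalars, the operators
  \<open>T t\<close>, and multiples of resolvents.\<close>

lemma
  assumes f: "bounded_linear f" and comm: "\<And>h x. h > 0 \<Longrightarrow> T h (f x) = f (T h x)" and x: "x \<in> D"
  shows D_commuting: "f x \<in> D" and A_commuting: "A (f x) = f (A x)"
proof -
  interpret f: bounded_linear f by fact
  have "((\<lambda>h. f ((T h x - x) /\<^sub>R h)) \<longlongrightarrow> f (- A x)) (at_right 0)"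
    by (intro f.tendsto generator_tendsto x)
  moreover have "\<forall>\<^sub>F h in at_right 0. f ((T h x - x) /\<^sub>R h) = (T h (f x) - f x) /\<^sub>R h"
    using eventually_pos_at_right by eventually_elim (simp add: comm f.scaleR f.diff)
  ultimately have "((\<lambda>h. (T h (f x) - f x) /\<^sub>R h) \<longlongrightarrow> - f (A x)) (at_right 0)"
    by (simp add: tendsto_cong f.neg)
  from generatorI[OF this] show "f x \<in> D" "A (f x) = f (A x)" by auto
qed

lemma D_scaleC: "x \<in> D \<Longrightarrow> c *\<^sub>C x \<in> D" and A_scaleC: "x \<in> D \<Longrightarrow> A (c *\<^sub>C x) = c *\<^sub>C A x"
  using D_commuting[OF bounded_linear_scaleC, of c x] A_commuting[OF bounded_linear_scaleC, of c x]
  by (simp_all add: T_scaleC)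

lemma D_T: "t \<ge> 0 \<Longrightarrow> x \<in> D \<Longrightarrow> T t x \<in> D" and A_T: "t \<ge> 0 \<Longrightarrow> x \<in> D \<Longrightarrow> A (T t x) = T t (A x)"
  using D_commuting[OF T_linear, of t x] A_commuting[OF T_linear, of t x] by (simp_all add: T_commute)

lemma D_minus: "x \<in> D \<Longrightarrow> - x \<in> D" and A_minus: "x \<in> D \<Longrightarrow> A (- x) = - A x"
  using D_scaleC[of x "-1"] A_scaleC[of x "-1"] by simp_all

lemma D_diff: "x \<in> D \<Longrightarrow> y \<in> D \<Longrightarrow> x - y \<in> D" and A_diff: "x \<in> D \<Longrightarrow> y \<in> D \<Longrightarrow> A (x - y) = A x - A y"
  using D_add[of x "- y"] A_add[of x "- y"] D_minus[of y] A_minus[of y] by simp_all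

text \<open>In the equivalent norm \<open>sup\<^sub>t \<parallel>T t x\<parallel>\<close> the semigroup is contractive, and for contractions the
  generator is dissipative: \<open>T h x\<close> equals \<open>(1 + h z) x - h (z x + A x)\<close> up to \<open>o(h)\<close>, so
  comparing norms and dividing by \<open>h\<close> gives the claim. Stating it for a uniform bound \<open>c\<close> of the
  orbit makes it iterable, which the Hille-Yosida bounds on powers of resolvents require.\<close>

lemma dissipative:
  assumes x: "x \<in> D" and z: "Re z > 0" and c: "\<And>t. t \<ge> 0 \<Longrightarrow> norm (T t (z *\<^sub>C x + A x)) \<le> c"
    and t: "t \<ge> 0"
  shows "Re z * norm (T t x) \<le> c"
proof -
  \<comment> \<open>\<open>S\<close> is the equivalent norm of \<open>x\<close>, and \<open>e\<close> the error of the difference quotient.\<close>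
  define S where "S = (SUP t\<in>{0..}. norm (T t x))"
  define e where "e h = (T h x - x) /\<^sub>R h - (- A x)" for h
  have bdd: "bdd_above ((\<lambda>t. norm (T t x)) ` {0..})"
    by (rule bdd_aboveI2[where M = "K * norm x"]) (simp add: T_bound)
  have le_S: "norm (T t x) \<le> S" if "t \<ge> 0" for t
    unfolding S_def using that by (intro cSUP_upper bdd) auto
  have step: "Re z * S \<le> c + K * norm (e h)" if h: "h > 0" for h
  proof -
    have *: "(1 + h * Re z) * norm (T t x) \<le> S + h * c + h * (K * norm (e h))" if t: "t \<ge> 0" for t
    proof -
      have "(1 + complex_of_real h * z) *\<^sub>C x = T h x + h *\<^sub>R (z *\<^sub>C x + A x) - h *\<^sub>R e h"
        using h by (simp add: e_def scaleC_add_left scaleR_scaleC[of h "z *\<^sub>C x"] scaleC_scaleC algebra_simps)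
      then have "T t ((1 + complex_of_real h * z) *\<^sub>C x) = T t (T h x) + h *\<^sub>R T t (z *\<^sub>C x + A x) - h *\<^sub>R T t (e h)"
        by (simp add: T_plus T_diff T_scaleR t)
      also have "T t (T h x) = T (t + h) x"
        using T_add[of t h] t h by simp
      finally have "norm (T t ((1 + complex_of_real h * z) *\<^sub>C x))
          \<le> norm (T (t + h) x) + h * norm (T t (z *\<^sub>C x + A x)) + h * norm (T t (e h))"
        using h norm_triangle_ineq4[of "T (t + h) x + h *\<^sub>R T t (z *\<^sub>C x + A x)" "h *\<^sub>R T t (e h)"]
          norm_triangle_ineq[of "T (t + h) x" "h *\<^sub>R T t (z *\<^sub>C x + A x)"]
        by simp
      also have "\<dots> \<le> S + h * c + h * (K * norm (e h))"
        using h t by (intro add_mono mult_left_mono le_S c T_bound) auto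
      finally have "cmod (1 + complex_of_real h * z) * norm (T t x) \<le> S + h * c + h * (K * norm (e h))"
        using t by (simp add: T_scaleC norm_scaleC)
      moreover have "1 + h * Re z \<le> cmod (1 + complex_of_real h * z)"
        using complex_Re_le_cmod[of "1 + complex_of_real h * z"] by simp
      ultimately show ?thesis
        by (meson mult_right_mono norm_ge_zero order_trans)
    qed
    have "S \<le> (S + h * c + h * (K * norm (e h))) / (1 + h * Re z)"
      unfolding S_def
      by (rule cSUP_least) (use * h z in \<open>auto simp: S_def[symmetric] pos_le_divide_eq mult.commute add_pos_pos\<close>)
    then have "(1 + h * Re z) * S \<le> S + h * c + h * (K * norm (e h))"
      using h z by (simp add: pos_le_divide_eq mult.commute add_pos_pos)
    then have "h * (Re z * S) \<le> h * (c + K * norm (e h))"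
      by (simp add: algebra_simps)
    then show ?thesis using h by simp
  qed
  have "(e \<longlongrightarrow> 0) (at_right 0)"
    unfolding e_def by (rule LIM_zero[OF generator_tendsto[OF x]])
  then have "((\<lambda>h. c + K * norm (e h)) \<longlongrightarrow> c + K * norm (0::'a)) (at_right 0)"
    by (intro tendsto_intros)
  then have "Re z * S \<le> c + K * norm (0::'a)"
    by (rule tendsto_lowerbound) (use eventually_pos_at_right step in \<open>auto elim: eventually_mono\<close>)
  moreover have "Re z * norm (T t x) \<le> Re z * S"
    using le_S[OF t] z by (intro mult_left_mono) auto
  ultimately show ?thesis by simp
qed

lemma coercive:
  assumes "x \<in> D" "Re z \<ge> 0"
  shows "Re z * norm x \<le> K * norm (z *\<^sub>C x + A x)"
proof (cases "Re z = 0")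
  case False
  then show ?thesis
    using dissipative[of x z "K * norm (z *\<^sub>C x + A x)" 0] assms T_bound by (auto simp: T_0)
qed (use K_ge_1 in auto)

text \<open>The resolvent of \<open>-A\<close>, that is \<open>(z + A)\<inverse>\<close>; in particular \<open>res 0\<close> is \<open>A\<inverse>\<close>.\<close>

definition res :: "complex \<Rightarrow> 'a \<Rightarrow> 'a" where
  "res z = inv_into D (\<lambda>x. z *\<^sub>C x + A x)"

lemma res_bij:
  assumes "bij_betw (\<lambda>x. z *\<^sub>C x + A x) D UNIV"
  shows "res z y \<in> D" "z *\<^sub>C res z y + A (res z y) = y" "x \<in> D \<Longrightarrow> res z (z *\<^sub>C x + A x) = x"
  using assms inv_into_into[of y "\<lambda>x. z *\<^sub>C x + A x" D] f_inv_into_f[of y "\<lambda>x. z *\<^sub>C x + A x" D]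
    inv_into_f_f[of "\<lambda>x. z *\<^sub>C x + A x" D x]
  by (auto simp: res_def bij_betw_def)

lemma res_bij_diff:
  assumes bij: "bij_betw (\<lambda>x. z *\<^sub>C x + A x) D UNIV"
  shows "res z (x - y) = res z x - res z y"
proof -
  note r = res_bij[OF bij]
  have "res z (x - y) = res z (z *\<^sub>C (res z x - res z y) + A (res z x - res z y))"
    using r(2)[of x] r(2)[of y] by (simp add: A_diff r scaleC_diff_right algebra_simps)
  then show ?thesis by (simp add: r D_diff)
qed

text \<open>The equation \<open>(z + d) x + A x = y\<close> is the fixed point equation \<open>x = res z (y - d x)\<close>, whose
  right-hand side is a contraction when \<open>d\<close> is small.\<close>

lemma resolvent_perturb:
  assumes bij: "bij_betw (\<lambda>x. z *\<^sub>C x + A x) D UNIV"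
    and m: "\<And>y. norm (res z y) \<le> m * norm y" and d: "cmod d * m \<le> 1/2"
  shows "\<exists>x\<in>D. (z + d) *\<^sub>C x + A x = y"
proof -
  have "norm (res z (y - d *\<^sub>C u) - res z (y - d *\<^sub>C v)) \<le> 1/2 * norm (u - v)" for u v
  proof -
    have "res z (y - d *\<^sub>C u) - res z (y - d *\<^sub>C v) = res z (d *\<^sub>C (v - u))"
      by (simp add: res_bij_diff[OF bij, symmetric] scaleC_diff_right)
    also have "norm \<dots> \<le> cmod d * m * norm (v - u)"
      using m[of "d *\<^sub>C (v - u)"] by (simp add: norm_scaleC mult_ac)
    also have "\<dots> \<le> 1/2 * norm (u - v)"
      unfolding norm_minus_commute[of v] by (rule mult_right_mono[OF d]) simp
    finally show ?thesis .
  qed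
  then have "\<exists>!x\<in>UNIV. res z (y - d *\<^sub>C x) = x"
    by (intro Banach_fix[where c = "1/2"]) (auto simp: complete_UNIV dist_norm)
  then obtain x where x: "res z (y - d *\<^sub>C x) = x" by blast
  have "x \<in> D" using res_bij(1)[OF bij] x by metis
  moreover have "z *\<^sub>C x + A x = y - d *\<^sub>C x" using res_bij(2)[OF bij, of "y - d *\<^sub>C x"] x by simp
  then have "(z + d) *\<^sub>C x + A x = y" by (simp add: scaleC_add_left algebra_simps)
  ultimately show ?thesis by blast
qed

text \<open>An a priori bound to the right of \<open>i s\<close> that does not deteriorate with \<open>\<sigma>\<close>: apply the
  resolvent at \<open>i s\<close> and control the shift \<open>\<sigma> x\<close> by coercivity.\<close>

lemma half_plane_lower_bound:
  assumes m: "\<And>y. norm (res (\<i> * complex_of_real s) y) \<le> m * norm y" and m0: "m \<ge> 0"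
    and x: "x \<in> D" and \<sigma>: "\<sigma> \<ge> 0"
  shows "norm x \<le> (1 + K) * m * norm ((\<i> * complex_of_real s + complex_of_real \<sigma>) *\<^sub>C x + A x)"
proof -
  let ?z = "\<i> * complex_of_real s + complex_of_real \<sigma>"
  let ?y = "?z *\<^sub>C x + A x"
  have "x = res (\<i> * s) ((\<i> * complex_of_real s) *\<^sub>C x + A x)"
    using res_bij(3)[OF imag_bij x] by simp
  also have "norm \<dots> \<le> m * norm (?y - complex_of_real \<sigma> *\<^sub>C x)"
    using m[of "(\<i> * complex_of_real s) *\<^sub>C x + A x"] by (simp add: scaleC_add_left algebra_simps)
  also have "\<dots> \<le> m * (norm ?y + K * norm ?y)"
  proof (rule mult_left_mono[OF _ m0])
    have "norm (?y - complex_of_real \<sigma> *\<^sub>C x) \<le> norm ?y + \<sigma> * norm x"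
      using norm_triangle_ineq4[of ?y "complex_of_real \<sigma> *\<^sub>C x"] \<sigma> by (simp add: norm_scaleC)
    also have "\<sigma> * norm x \<le> K * norm ?y"
      using coercive[OF x, of ?z] \<sigma> by simp
    finally show "norm (?y - complex_of_real \<sigma> *\<^sub>C x) \<le> norm ?y + K * norm ?y" by simp
  qed
  also have "\<dots> = (1 + K) * m * norm ?y" by (simp add: algebra_simps)
  finally show ?thesis .
qed

lemma imag_resolvent_bound:
  obtains m where "m > 0" "\<And>y. norm (res (\<i> * complex_of_real s) y) \<le> m * norm y"
proof -
  obtain B where B: "\<And>y. norm (res (\<i> * complex_of_real s) y) \<le> B * norm y"
    using imag_bounded[of s] unfolding res_def by blast
  have "B * norm y \<le> max 1 B * norm y" for y :: 'a by (rule mult_right_mono) auto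
  then show ?thesis using that[of "max 1 B"] B by (meson less_le_trans max.cobounded1 order_trans zero_less_one)
qed

text \<open>The method of continuity replaces the Laplace integral of the semigroup: because the a priori
  bound is uniform along the horizontal line through \<open>z\<close>, invertibility propagates from the
  imaginary axis to the right in steps of a fixed length \<open>d\<close>.\<close>

lemma half_plane_bij:
  assumes "Re z \<ge> 0"
  shows "bij_betw (\<lambda>x. z *\<^sub>C x + A x) D UNIV"
proof -
  define s where "s = Im z"
  obtain m where m: "m > 0" "\<And>y. norm (res (\<i> * complex_of_real s) y) \<le> m * norm y"
    using imag_resolvent_bound by blast
  define m' where "m' = (1 + K) * m"
  define d where "d = 1 / (2 * m')"
  have m': "m' > 0" using m K_ge_1 by (simp add: m'_def)
  then have d0: "d > 0" by (simp add: d_def)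
  define w where "w \<sigma> = \<i> * complex_of_real s + complex_of_real \<sigma>" for \<sigma>
  note low = half_plane_lower_bound[OF m(2) less_imp_le[OF m(1)], folded w_def m'_def]
  have bij: "bij_betw (\<lambda>x. w \<sigma> *\<^sub>C x + A x) D UNIV"
    if surj: "\<And>y. \<exists>x\<in>D. w \<sigma> *\<^sub>C x + A x = y" and \<sigma>: "\<sigma> \<ge> 0" for \<sigma>
    unfolding bij_betw_def
  proof
    show "inj_on (\<lambda>x. w \<sigma> *\<^sub>C x + A x) D"
    proof (rule inj_onI)
      fix x y assume xy: "x \<in> D" "y \<in> D" "w \<sigma> *\<^sub>C x + A x = w \<sigma> *\<^sub>C y + A y"
      have "norm (x - y) \<le> m' * norm (w \<sigma> *\<^sub>C (x - y) + A (x - y))"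
        by (rule low[OF D_diff[OF xy(1,2)] \<sigma>])
      also have "w \<sigma> *\<^sub>C (x - y) + A (x - y) = 0"
        using xy by (simp add: A_diff scaleC_diff_right algebra_simps)
      finally show "x = y" by simp
    qed
    show "(\<lambda>x. w \<sigma> *\<^sub>C x + A x) ` D = UNIV"
    proof (intro equalityI subsetI)
      fix y obtain x where "x \<in> D" "w \<sigma> *\<^sub>C x + A x = y" using surj by blast
      then show "y \<in> (\<lambda>x. w \<sigma> *\<^sub>C x + A x) ` D" by blast
    qed simp
  qed
  have "\<forall>\<sigma>. 0 \<le> \<sigma> \<and> \<sigma> \<le> real n * d \<longrightarrow> bij_betw (\<lambda>x. w \<sigma> *\<^sub>C x + A x) D UNIV" for n
  proof (induction n)
    case 0
    then show ?case using imag_bij[of s] by (auto simp: w_def)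
  next
    case (Suc n)
    show ?case
    proof (intro allI impI, elim conjE)
      fix \<sigma> assume \<sigma>: "0 \<le> \<sigma>" "\<sigma> \<le> real (Suc n) * d"
      define \<tau> where "\<tau> = max 0 (\<sigma> - d)"
      have \<tau>: "0 \<le> \<tau>" "\<tau> \<le> real n * d" "\<bar>\<sigma> - \<tau>\<bar> \<le> d"
        using \<sigma> d0 by (auto simp: \<tau>_def algebra_simps)
      then have b: "bij_betw (\<lambda>x. w \<tau> *\<^sub>C x + A x) D UNIV" using Suc by blast
      have "norm (res (w \<tau>) y) \<le> m' * norm y" for y
        using low[OF res_bij(1)[OF b] \<tau>(1)] res_bij(2)[OF b] by simp
      moreover have "cmod (complex_of_real (\<sigma> - \<tau>)) * m' \<le> 1/2"
        using mult_right_mono[OF \<tau>(3), of m'] m' by (simp only: norm_of_real) (simp add: d_def)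
      ultimately have "\<exists>x\<in>D. (w \<tau> + complex_of_real (\<sigma> - \<tau>)) *\<^sub>C x + A x = y" for y
        by (rule resolvent_perturb[OF b])
      then show "bij_betw (\<lambda>x. w \<sigma> *\<^sub>C x + A x) D UNIV"
        by (intro bij \<sigma>) (simp add: w_def)
    qed
  qed
  moreover obtain n where "Re z \<le> real n * d"
    using reals_Archimedean3[OF d0] by (metis less_imp_le)
  moreover have "w (Re z) = z" by (simp add: w_def s_def complex_eq_iff)
  ultimately show ?thesis using assms by metis
qed

lemmas res_in_D = res_bij(1)[OF half_plane_bij]
lemmas res_right_inverse = res_bij(2)[OF half_plane_bij]
lemmas res_left_inverse = res_bij(3)[OF half_plane_bij]
lemmas res_diff = res_bij_diff[OF half_plane_bij]

lemma res_eqI: "Re z \<ge> 0 \<Longrightarrow> x \<in> D \<Longrightarrow> z *\<^sub>C x + A x = y \<Longrightarrow> res z y = x"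
  using res_left_inverse by blast

lemma A_res: "Re z \<ge> 0 \<Longrightarrow> A (res z y) = y - z *\<^sub>C res z y"
  using res_right_inverse[of z y] by (simp add: algebra_simps)

lemma res_plus: "Re z \<ge> 0 \<Longrightarrow> res z (x + y) = res z x + res z y"
  by (rule res_eqI) (auto simp: res_in_D D_add A_add A_res scaleC_add_right)

lemma res_scaleC: "Re z \<ge> 0 \<Longrightarrow> res z (c *\<^sub>C y) = c *\<^sub>C res z y"
  by (rule res_eqI) (auto simp: res_in_D D_scaleC A_scaleC A_res scaleC_diff_right scaleC_left_commute)

lemma res_bound:
  assumes "Re z > 0" shows "norm (res z y) \<le> K / Re z * norm y"
  using coercive[OF res_in_D[of z y], of z] res_right_inverse[of z y] assms by (simp add: field_simps)

lemma res_bounded: "Re z \<ge> 0 \<Longrightarrow> \<exists>B\<ge>0. \<forall>y. norm (res z y) \<le> B * norm y"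
proof (cases "Re z = 0")
  case True
  then have "z = \<i> * complex_of_real (Im z)" by (simp add: complex_eq_iff)
  then show ?thesis using imag_resolvent_bound[of "Im z"] by (metis less_imp_le)
next
  case False
  assume "Re z \<ge> 0"
  then show ?thesis using False res_bound[of z] K_ge_1
    by (intro exI[of _ "K / Re z"]) auto
qed

lemma res_linear: "Re z \<ge> 0 \<Longrightarrow> bounded_linear (res z)"
proof -
  assume z: "Re z \<ge> 0"
  obtain B where "\<forall>y. norm (res z y) \<le> B * norm y" using res_bounded[OF z] by blast
  then show ?thesis
    by (intro bounded_linear_intro[where K = B])
      (use z in \<open>auto simp: res_plus res_scaleC scaleR_scaleC mult.commute\<close>)
qed

lemma res_identity:
  assumes "Re z \<ge> 0" "Re w \<ge> 0"
  shows "res z y - res w y = (w - z) *\<^sub>C res z (res w y)"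
proof -
  have "res z (z *\<^sub>C res w y + A (res w y)) = res w y"
    using assms by (simp add: res_left_inverse res_in_D)
  moreover have "z *\<^sub>C res w y + A (res w y) = y - (w - z) *\<^sub>C res w y"
    using assms by (simp add: A_res scaleC_diff_left)
  ultimately have "res z y - (w - z) *\<^sub>C res z (res w y) = res w y"
    using assms by (simp only: res_diff res_scaleC)
  then show ?thesis by (metis add_diff_cancel_left' diff_add_cancel)
qed

lemma res_commute:
  assumes "Re z \<ge> 0" "Re w \<ge> 0"
  shows "res z (res w y) = res w (res z y)"
proof (cases "z = w")
  case False
  have "(w - z) *\<^sub>C res z (res w y) = (w - z) *\<^sub>C res w (res z y)"
    using res_identity[OF assms, of y] res_identity[OF assms(2,1), of y]
    by (metis minus_diff_eq scaleC_minus_left minus_minus)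
  then have "(1 / (w - z)) *\<^sub>C (w - z) *\<^sub>C res z (res w y) = (1 / (w - z)) *\<^sub>C (w - z) *\<^sub>C res w (res z y)"
    by simp
  then show ?thesis using False by (simp add: scaleC_scaleC)
qed simp

lemma res_T_commute: "Re z \<ge> 0 \<Longrightarrow> t \<ge> 0 \<Longrightarrow> res z (T t y) = T t (res z y)"
  by (rule res_eqI) (auto simp: D_T A_T res_in_D A_res T_diff T_scaleC)

end

section \<open>Smoothing by resolvents\<close>

lemma funpow_commute_elem:
  assumes "\<And>x. f (g x) = g (f x)"
  shows "(f ^^ n) ((g ^^ m) x) = (g ^^ m) ((f ^^ n) x)"
proof -
  have *: "f ((g ^^ m) x) = (g ^^ m) (f x)" for m x
    by (induction m) (auto simp: assms)
  show ?thesis by (induction n) (auto simp: *)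
qed

lemma funpow_bound:
  fixes f :: "'a::real_normed_vector \<Rightarrow> 'a"
  assumes "\<And>x. norm (f x) \<le> B * norm x" "B \<ge> 0"
  shows "norm ((f ^^ n) x) \<le> B ^ n * norm x"
proof (induction n)
  case (Suc n)
  have "norm ((f ^^ Suc n) x) \<le> B * norm ((f ^^ n) x)" using assms(1) by simp
  also have "\<dots> \<le> B * (B ^ n * norm x)" by (intro mult_left_mono Suc assms)
  finally show ?case by simp
qed simp

lemma bounded_linear_funpow:
  fixes f :: "'a::real_normed_vector \<Rightarrow> 'a"
  shows "bounded_linear f \<Longrightarrow> bounded_linear (f ^^ n)"
  by (induction n) (auto simp: o_def id_def intro: bounded_linear_compose bounded_linear_ident)

context bounded_semigroup
begin

text \<open>The Yosida regularisation \<open>\<rho> (\<rho> + A)\<inverse>\<close>. It damps frequencies above \<open>\<rho>\<close>; for large \<open>\<rho>\<close> it is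
  also the implicit Euler step of length \<open>1 / \<rho>\<close> for the semigroup. Both readings are used below.\<close>

definition J :: "real \<Rightarrow> 'a \<Rightarrow> 'a" where
  "J \<rho> y = \<rho> *\<^sub>R res (complex_of_real \<rho>) y"

lemma J_linear: "\<rho> > 0 \<Longrightarrow> bounded_linear (J \<rho>)"
  unfolding J_def by (intro bounded_linear_scaleR_right[THEN bounded_linear_compose] res_linear) simp

lemma J_scaleC: "\<rho> > 0 \<Longrightarrow> J \<rho> (c *\<^sub>C y) = c *\<^sub>C J \<rho> y"
  by (simp add: J_def res_scaleC scaleR_scaleC scaleC_left_commute)

lemma J_in_D: "\<rho> > 0 \<Longrightarrow> J \<rho> y \<in> D"
  by (simp add: J_def scaleR_scaleC D_scaleC res_in_D)

lemma A_J: "\<rho> > 0 \<Longrightarrow> A (J \<rho> y) = \<rho> *\<^sub>R (y - J \<rho> y)"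
  by (simp add: J_def scaleR_scaleC A_scaleC res_in_D A_res scaleC_diff_right scaleC_scaleC)

lemma J_res_commute: "\<rho> > 0 \<Longrightarrow> Re z \<ge> 0 \<Longrightarrow> J \<rho> (res z y) = res z (J \<rho> y)"
  by (simp add: J_def res_commute[of "complex_of_real \<rho>"] scaleR_scaleC res_scaleC)

lemma J_T_commute: "\<rho> > 0 \<Longrightarrow> t \<ge> 0 \<Longrightarrow> J \<rho> (T t y) = T t (J \<rho> y)"
  by (simp add: J_def res_T_commute T_scaleR)

lemma J_J_commute: "\<rho> > 0 \<Longrightarrow> \<mu> > 0 \<Longrightarrow> J \<rho> (J \<mu> y) = J \<mu> (J \<rho> y)"
  by (simp add: J_def res_commute[of "complex_of_real \<rho>"] scaleR_scaleC res_scaleC scaleC_left_commute)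

text \<open>The Hille-Yosida bound: each application of \<open>J \<rho>\<close> preserves a uniform bound of the orbit, so
  the constant \<open>K\<close> is paid only once and not once per factor.\<close>

lemma J_power_bound:
  assumes \<rho>: "\<rho> > 0"
  shows "norm ((J \<rho> ^^ k) y) \<le> K * norm y"
proof -
  have "norm (T t ((J \<rho> ^^ k) y)) \<le> K * norm y" if "t \<ge> 0" for t
    using that
  proof (induction k arbitrary: t)
    case (Suc k)
    define u where "u = (J \<rho> ^^ k) y"
    have "Re (complex_of_real \<rho>) * norm (T t (res (complex_of_real \<rho>) u)) \<le> K * norm y"
    proof (rule dissipative)
      show "norm (T t (complex_of_real \<rho> *\<^sub>C res (complex_of_real \<rho>) u + A (res (complex_of_real \<rho>) u)))
          \<le> K * norm y" if "t \<ge> 0" for t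
        using Suc.IH[OF that] \<rho> by (simp add: res_right_inverse u_def)
    qed (use \<rho> Suc.prems in \<open>auto simp: res_in_D\<close>)
    then show ?case using \<rho> Suc.prems by (simp add: J_def[of \<rho> "(J \<rho> ^^ k) y"] u_def T_scaleR)
  qed (use T_bound in auto)
  from this[of 0] show ?thesis by (simp add: T_0)
qed

lemma J_bound: "\<rho> > 0 \<Longrightarrow> norm (J \<rho> y) \<le> K * norm y"
  using J_power_bound[of \<rho> 1 y] by simp

text \<open>Removing the frequencies above \<open>\<rho>\<close> from \<open>A\<inverse>\<close> costs an error of order \<open>1 / \<rho>\<close>:
  one application of \<open>J \<rho>\<close> changes \<open>A\<inverse> u\<close> by exactly \<open>J \<rho> u / \<rho>\<close>.\<close>

lemma high_frequency_part:
  assumes \<rho>: "\<rho> > 0"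
  shows "norm (res 0 y - res 0 ((J \<rho> ^^ q) y)) \<le> real q * K / \<rho> * norm y"
proof (induction q)
  case (Suc q)
  define u where "u = (J \<rho> ^^ q) y"
  have "res 0 (u - J \<rho> u) = (1 / \<rho>) *\<^sub>R J \<rho> u"
    by (rule res_eqI) (use \<rho> in \<open>auto simp: J_in_D A_J scaleR_scaleC D_scaleC A_scaleC scaleC_scaleC\<close>)
  then have "res 0 y - res 0 (J \<rho> u) = (res 0 y - res 0 u) + (1 / \<rho>) *\<^sub>R (J \<rho> ^^ Suc q) y"
    by (simp add: res_diff u_def algebra_simps)
  then have "norm (res 0 y - res 0 (J \<rho> u)) \<le> norm (res 0 y - res 0 u) + norm ((1 / \<rho>) *\<^sub>R (J \<rho> ^^ Suc q) y)"
    by (metis norm_triangle_ineq)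
  also have "\<dots> \<le> real q * K / \<rho> * norm y + 1 / \<rho> * (K * norm y)"
    using Suc.IH \<rho> J_power_bound[OF \<rho>, of "Suc q" y]
    by (intro add_mono) (auto simp: u_def divide_right_mono)
  finally show ?case using \<rho> by (simp add: u_def field_simps)
qed simp

text \<open>Bounds on the imaginary axis suffice: by the resolvent identity and \<open>\<parallel>res z\<parallel> \<le> K / Re z\<close>, moving
  a resolvent horizontally into the half-plane costs a factor \<open>1 + K\<close>.\<close>

lemma res_power_half_plane:
  assumes "\<sigma> \<ge> 0"
  shows "norm ((res (complex_of_real \<sigma> + \<i> * complex_of_real s) ^^ n) y)
    \<le> (1 + K) ^ n * norm ((res (\<i> * complex_of_real s) ^^ n) y)"
proof -
  let ?z = "complex_of_real \<sigma> + \<i> * complex_of_real s" and ?w = "\<i> * complex_of_real s"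
  have one: "norm (res ?z y) \<le> (1 + K) * norm (res ?w y)" for y
  proof (cases "\<sigma> = 0")
    case True
    then show ?thesis using K_ge_1 by (simp add: algebra_simps)
  next
    case False
    have "res ?z y = res ?w y - complex_of_real \<sigma> *\<^sub>C res ?z (res ?w y)"
      using res_identity[of ?z ?w y] assms by (simp add: algebra_simps)
    then have "norm (res ?z y) \<le> norm (res ?w y) + \<sigma> * norm (res ?z (res ?w y))"
      using assms by (metis norm_triangle_ineq4 norm_scaleC norm_of_real abs_of_nonneg)
    also have "\<sigma> * norm (res ?z (res ?w y)) \<le> \<sigma> * (K / \<sigma> * norm (res ?w y))"
      using res_bound[of ?z "res ?w y"] False assms by (intro mult_left_mono) auto
    finally show ?thesis using False by (simp add: algebra_simps)
  qed
  show ?thesis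
  proof (induction n arbitrary: y)
    case (Suc n)
    have comm: "(res ?w ^^ n) (res ?z y) = res ?z ((res ?w ^^ n) y)"
      using funpow_commute_elem[of "res ?w" "res ?z" n 1 y] assms by (simp add: res_commute)
    have "norm ((res ?z ^^ Suc n) y) \<le> (1 + K) ^ n * norm ((res ?w ^^ n) (res ?z y))"
      using Suc.IH[of "res ?z y"] by (simp only: funpow_Suc_right o_apply)
    also have "\<dots> \<le> (1 + K) ^ n * ((1 + K) * norm (res ?w ((res ?w ^^ n) y)))"
      unfolding comm using K_ge_1 by (intro mult_left_mono one) auto
    finally show ?case by (simp add: mult_ac)
  qed simp
qed

text \<open>On the imaginary axis \<open>A\<inverse>\<close> acts on the resolvent at \<open>i s\<close> like division by \<open>i s\<close>.\<close>

lemma res_inverse_gain: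
  assumes m: "\<And>y. norm (res (\<i> * complex_of_real s) y) \<le> m * norm y"
    and m0: "\<And>y. norm (res 0 y) \<le> m0 * norm y" and s: "s \<noteq> 0"
  shows "norm (res (\<i> * complex_of_real s) (res 0 y)) \<le> (m0 * norm y + norm (res (\<i> * complex_of_real s) y)) / \<bar>s\<bar>"
proof -
  let ?w = "\<i> * complex_of_real s"
  have "\<bar>s\<bar> * norm (res ?w (res 0 y)) = norm (res ?w y - res 0 y)"
    using res_identity[of ?w 0 y] by (simp add: norm_scaleC norm_mult)
  also have "\<dots> \<le> norm (res ?w y) + m0 * norm y"
    using norm_triangle_ineq4[of "res ?w y" "res 0 y"] m0[of y] by simp
  finally show ?thesis using s by (simp add: field_simps)
qed

text \<open>At frequencies above \<open>\<rho>\<close> each factor \<open>J \<rho>\<close> gains \<open>\<rho> / \<bar>s\<bar>\<close> on the part of the resolvent concentrated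
  near \<open>i s\<close>; the remaining part, of order \<open>1 / \<bar>s\<bar>\<close>, comes from the frequencies below \<open>\<rho>\<close>, which
  the smoothing leaves alone.\<close>

lemma res_J_gain:
  assumes m: "\<And>y. norm (res (\<i> * complex_of_real s) y) \<le> m * norm y"
    and \<rho>: "\<rho> > 0" and s: "\<rho> \<le> \<bar>s\<bar>"
  shows "norm (res (\<i> * complex_of_real s) ((J \<rho> ^^ p) y)) \<le> (real p * K / \<bar>s\<bar> + (\<rho> / \<bar>s\<bar>) ^ p * m) * norm y"
proof (induction p)
  case 0
  then show ?case using m by simp
next
  case (Suc p)
  let ?w = "\<i> * complex_of_real s"
  define u where "u = (J \<rho> ^^ p) y"
  have s0: "\<bar>s\<bar> > 0" using \<rho> s by simp
  have "res ?w u - res (complex_of_real \<rho>) u = (complex_of_real \<rho> - ?w) *\<^sub>C res ?w (res (complex_of_real \<rho>) u)"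
    using \<rho> by (intro res_identity) auto
  then have "complex_of_real \<rho> *\<^sub>C (res ?w u - res (complex_of_real \<rho>) u)
      = complex_of_real \<rho> *\<^sub>C (complex_of_real \<rho> - ?w) *\<^sub>C res ?w (res (complex_of_real \<rho>) u)"
    by simp
  then have "(complex_of_real \<rho> - ?w) *\<^sub>C res ?w (J \<rho> u) = \<rho> *\<^sub>R res ?w u - J \<rho> u"
    using \<rho> by (simp add: J_def scaleR_scaleC res_scaleC scaleC_diff_right scaleC_left_commute)
  then have "cmod (complex_of_real \<rho> - ?w) * norm (res ?w (J \<rho> u)) = norm (\<rho> *\<^sub>R res ?w u - J \<rho> u)"
    by (metis norm_scaleC)
  also have "\<dots> \<le> \<rho> * norm (res ?w u) + norm (J \<rho> u)"
    using norm_triangle_ineq4[of "\<rho> *\<^sub>R res ?w u" "J \<rho> u"] \<rho> by simp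
  also have "\<dots> \<le> \<rho> * ((real p * K / \<bar>s\<bar> + (\<rho> / \<bar>s\<bar>) ^ p * m) * norm y) + K * norm y"
    using Suc.IH \<rho> J_power_bound[OF \<rho>, of "Suc p" y] by (intro add_mono mult_left_mono) (auto simp: u_def)
  finally have 1: "cmod (complex_of_real \<rho> - ?w) * norm (res ?w (J \<rho> u)) \<le> \<dots>" .
  have "\<bar>s\<bar> \<le> cmod (complex_of_real \<rho> - ?w)"
    using abs_Im_le_cmod[of "complex_of_real \<rho> - ?w"] by simp
  from mult_right_mono[OF this norm_ge_zero] 1
  have "\<bar>s\<bar> * norm (res ?w (J \<rho> u)) \<le> \<rho> * ((real p * K / \<bar>s\<bar> + (\<rho> / \<bar>s\<bar>) ^ p * m) * norm y) + K * norm y"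
    by (rule order_trans)
  then have "norm (res ?w (J \<rho> u)) \<le> (\<rho> * ((real p * K / \<bar>s\<bar> + (\<rho> / \<bar>s\<bar>) ^ p * m) * norm y) + K * norm y) / \<bar>s\<bar>"
    using s0 by (simp add: pos_le_divide_eq mult.commute)
  also have "\<dots> = (\<rho> / \<bar>s\<bar>) * (real p * K / \<bar>s\<bar> * norm y) + (\<rho> / \<bar>s\<bar>) ^ Suc p * m * norm y + K / \<bar>s\<bar> * norm y"
    using s0 by (simp add: field_simps)
  also have "\<dots> \<le> 1 * (real p * K / \<bar>s\<bar> * norm y) + (\<rho> / \<bar>s\<bar>) ^ Suc p * m * norm y + K / \<bar>s\<bar> * norm y"
    using s s0 K_ge_1 by (intro add_mono mult_right_mono order_refl) auto
  also have "\<dots> = (real (Suc p) * K / \<bar>s\<bar> + (\<rho> / \<bar>s\<bar>) ^ Suc p * m) * norm y"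
    by (simp add: algebra_simps add_divide_distrib)
  finally show ?case by (simp add: u_def)
qed

definition smoothed_inverse :: "real \<Rightarrow> nat \<Rightarrow> 'a \<Rightarrow> 'a" where
  "smoothed_inverse \<rho> q y = res 0 ((J \<rho> ^^ q) y)"

text \<open>Here \<open>\<tau>\<close> stands for a multiple of \<open>M(\<rho>)\<close>. After smoothing, the \<open>n\<close>-th powers of all resolvents on
  the imaginary axis obey the one bound \<open>\<tau>\<^sup>n / \<rho>\<close> that is expected at the frequency \<open>\<rho>\<close>. Below \<open>\<rho>\<close>
  the factor \<open>A\<inverse>\<close> contributes only \<open>1 / \<bar>s\<bar>\<close>; the loss \<open>\<rho> / \<bar>s\<bar>\<close> is compensated by the growth of
  the \<open>n\<close>-th power of the resolvent bound, because \<open>n \<beta> \<ge> 1\<close>. This is why powers are needed when the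
  resolvent grows slowly. Above \<open>\<rho>\<close>, each of the \<open>n\<close> resolvents is paired with \<open>p\<close> factors \<open>J \<rho>\<close> that
  compensate its growth. The remaining frequencies \<open>\<bar>s\<bar> \<le> s1\<close> are harmless, since \<open>mid\<close> at \<open>s1\<close> forces
  \<open>\<tau>\<^sup>n / \<rho> \<ge> 1 / s1\<close>.\<close>

lemma smoothed_resolvent_bound:
  fixes m :: "real \<Rightarrow> real" and n p :: nat
  assumes m: "\<And>s y. norm (res (\<i> * complex_of_real s) y) \<le> m s * norm y"
    and m0: "\<And>y. norm (res 0 y) \<le> m0 * norm y" and m0_nonneg: "m0 \<ge> 0"
    and s1: "s1 \<ge> 1" "s1 \<le> \<rho>" and n: "n \<ge> 1" "real n * \<beta> \<ge> 1" and c: "c \<ge> 0" and \<tau>: "\<tau> > 0"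
    and low: "\<And>s. \<bar>s\<bar> \<le> s1 \<Longrightarrow> m s \<le> c"
    and mid: "\<And>s. s1 \<le> \<bar>s\<bar> \<Longrightarrow> \<bar>s\<bar> \<le> \<rho> \<Longrightarrow> max 1 (m s) \<le> \<tau> * (\<bar>s\<bar> / \<rho>) powr \<beta>"
    and high: "\<And>s. \<rho> \<le> \<bar>s\<bar> \<Longrightarrow> m s \<le> \<tau> * (\<bar>s\<bar> / \<rho>) ^ p"
  defines "C \<equiv> c ^ n * m0 * K * s1 + (m0 + 1) * K + (real p * K + 1) ^ n * (m0 * K + 1)"
  shows "norm ((res (\<i> * complex_of_real s) ^^ n) (smoothed_inverse \<rho> (n * p) y)) \<le> C * \<tau> ^ n / \<rho> * norm y"
proof -
  let ?w = "\<i> * complex_of_real s"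
  define q where "q = n * p"
  define u where "u = (J \<rho> ^^ q) y"
  have \<rho>: "\<rho> > 0" "\<rho> \<ge> 1" using s1 by auto
  have u: "norm u \<le> K * norm y" unfolding u_def by (rule J_power_bound[OF \<rho>(1)])
  have \<tau>1: "\<tau> \<ge> 1" using mid[of \<rho>] s1 \<rho> by simp
  obtain n' where n': "n = Suc n'" using n(1) by (cases n) auto
  define C1 C2 C3 where "C1 = c ^ n * m0 * K * s1" and "C2 = (m0 + 1) * K"
    and "C3 = (real p * K + 1) ^ n * (m0 * K + 1)"
  have C_nonneg: "C1 \<ge> 0" "C2 \<ge> 0" "C3 \<ge> 0"
    using c m0_nonneg K_ge_1 s1 by (auto simp: C1_def C2_def C3_def)
  \<comment> \<open>Since \<open>n \<beta> \<ge> 1\<close>, the decrease of the \<open>n\<close>-th power from \<open>\<rho>\<close> down to \<open>x\<close> outweighs the loss \<open>\<rho> / x\<close>.\<close>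
  have mid_power: "(\<tau> * (x / \<rho>) powr \<beta>) ^ n \<le> \<tau> ^ n * (x / \<rho>)" if x: "s1 \<le> x" "x \<le> \<rho>" for x
  proof -
    have x0: "x > 0" using x s1 by simp
    have "((x / \<rho>) powr \<beta>) ^ n = (x / \<rho>) powr (real n * \<beta>)"
      using x0 \<rho> by (simp add: powr_powr powr_realpow[symmetric] mult.commute)
    also have "\<dots> \<le> (x / \<rho>) powr 1"
      using n(2) x x0 \<rho> by (intro powr_mono') auto
    finally have "\<tau> ^ n * ((x / \<rho>) powr \<beta>) ^ n \<le> \<tau> ^ n * (x / \<rho>)"
      using x0 \<rho> \<tau> by (intro mult_left_mono) auto
    then show ?thesis by (simp only: power_mult_distrib)
  qed
  have goal_le: "C' * \<tau> ^ n / \<rho> * norm y \<le> C * \<tau> ^ n / \<rho> * norm y" if "C' \<le> C" for C'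
    using that \<tau> \<rho> by (intro mult_right_mono divide_right_mono) auto
  have C: "C1 \<le> C" "C2 \<le> C" "C3 \<le> C"
    using C_nonneg by (auto simp: C_def C1_def C2_def C3_def)
  consider "\<bar>s\<bar> \<le> s1" | "s1 \<le> \<bar>s\<bar>" "\<bar>s\<bar> \<le> \<rho>" | "\<rho> \<le> \<bar>s\<bar>" by linarith
  then show ?thesis
  proof cases
    case 1
    have "1 ^ n \<le> (\<tau> * (s1 / \<rho>) powr \<beta>) ^ n"
      using mid[of s1] s1 by (intro power_mono) auto
    also have "\<dots> \<le> \<tau> ^ n * (s1 / \<rho>)" using s1 by (intro mid_power) auto
    finally have small: "1 \<le> s1 * \<tau> ^ n / \<rho>" by (simp add: mult.commute)
    have "norm ((res ?w ^^ n) (res 0 u)) \<le> c ^ n * norm (res 0 u)"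
    proof (rule funpow_bound[OF _ c])
      show "norm (res ?w y) \<le> c * norm y" for y
        using m[of s y] mult_right_mono[OF low[OF 1] norm_ge_zero[of y]] by linarith
    qed
    also have "\<dots> \<le> c ^ n * (m0 * (K * norm y))"
      using m0[of u] u m0_nonneg c by (intro mult_left_mono order_trans[OF m0] u) auto
    also have "\<dots> \<le> (c ^ n * (m0 * (K * norm y))) * (s1 * \<tau> ^ n / \<rho>)"
      using mult_left_mono[OF small, of "c ^ n * (m0 * (K * norm y))"] c m0_nonneg K_ge_1 by simp
    also have "\<dots> = C1 * \<tau> ^ n / \<rho> * norm y" by (simp add: C1_def)
    also note goal_le[OF C(1)]
    finally show ?thesis by (simp add: smoothed_inverse_def u_def q_def)
  next
    case 2
    define X where "X = \<tau> * (\<bar>s\<bar> / \<rho>) powr \<beta>"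
    have X: "1 \<le> X" "m s \<le> X" using mid[OF 2] by (auto simp: X_def)
    have s0: "\<bar>s\<bar> > 0" "s \<noteq> 0" using 2 s1 by auto
    have mX: "norm (res ?w y) \<le> X * norm y" for y
      using m[of s y] mult_right_mono[OF X(2) norm_ge_zero[of y]] by linarith
    have "norm ((res ?w ^^ n) (res 0 u)) = norm ((res ?w ^^ n') (res ?w (res 0 u)))"
      by (simp add: n' funpow_swap1)
    also have "\<dots> \<le> X ^ n' * norm (res ?w (res 0 u))"
      using X mX by (intro funpow_bound) auto
    also have "\<dots> \<le> X ^ n' * ((m0 * norm u + norm (res ?w u)) / \<bar>s\<bar>)"
      using X by (intro mult_left_mono res_inverse_gain[OF m m0] s0) auto
    also have "\<dots> \<le> X ^ n' * (((m0 + 1) * X * (K * norm y)) / \<bar>s\<bar>)"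
    proof -
      have "m0 * norm u \<le> m0 * X * norm u"
        using mult_left_mono[OF X(1) m0_nonneg] by (intro mult_right_mono) auto
      then have "m0 * norm u + norm (res ?w u) \<le> (m0 + 1) * X * norm u"
        using mX[of u] by (simp add: algebra_simps)
      also have "\<dots> \<le> (m0 + 1) * X * (K * norm y)"
        using u X m0_nonneg by (intro mult_left_mono) auto
      finally show ?thesis using X s0 by (intro mult_left_mono divide_right_mono) auto
    qed
    also have "\<dots> = C2 * (X ^ n / \<bar>s\<bar>) * norm y"
      by (simp add: C2_def n')
    also have "\<dots> \<le> C2 * (\<tau> ^ n / \<rho>) * norm y"
    proof -
      have "X ^ n \<le> \<tau> ^ n / \<rho> * \<bar>s\<bar>" using mid_power[of "\<bar>s\<bar>"] 2 by (simp add: X_def)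
      then have "X ^ n / \<bar>s\<bar> \<le> \<tau> ^ n / \<rho>" using s0 by (simp add: pos_divide_le_eq)
      then show ?thesis using C_nonneg by (intro mult_right_mono mult_left_mono) auto
    qed
    also have "\<dots> \<le> C * \<tau> ^ n / \<rho> * norm y" using goal_le[OF C(2)] by simp
    finally show ?thesis by (simp add: smoothed_inverse_def u_def q_def)
  next
    case 3
    \<comment> \<open>\<open>n\<close> blocks, each consisting of one resolvent and \<open>p\<close> smoothing factors\<close>
    define E where "E v = res ?w ((J \<rho> ^^ p) v)" for v
    define B where "B = (real p * K + 1) * \<tau>"
    have s0: "\<bar>s\<bar> > 0" "s \<noteq> 0" "\<bar>s\<bar> \<ge> 1" using 3 \<rho> by auto
    have pK: "real p * K \<ge> 0" using K_ge_1 by simp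
    have B1: "B \<ge> 1" using pK \<tau>1 mult_mono[of 1 "real p * K + 1" 1 \<tau>] by (simp add: B_def)
    have EB: "norm (E v) \<le> B * norm v" for v
    proof -
      have "norm (E v) \<le> (real p * K / \<bar>s\<bar> + (\<rho> / \<bar>s\<bar>) ^ p * m s) * norm v"
        unfolding E_def by (rule res_J_gain[OF m \<rho>(1) 3])
      moreover have "real p * K / \<bar>s\<bar> \<le> real p * K * \<tau>"
      proof -
        have "real p * K / \<bar>s\<bar> \<le> real p * K / 1" using pK s0 by (intro divide_left_mono) auto
        also have "\<dots> \<le> real p * K * \<tau>" using mult_left_mono[OF \<tau>1 pK] by simp
        finally show ?thesis .
      qed
      moreover have "(\<rho> / \<bar>s\<bar>) ^ p * m s \<le> \<tau>"
      proof -
        have "(\<rho> / \<bar>s\<bar>) ^ p * m s \<le> (\<rho> / \<bar>s\<bar>) ^ p * (\<tau> * (\<bar>s\<bar> / \<rho>) ^ p)"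
          using \<rho> by (intro mult_left_mono high[OF 3]) auto
        also have "\<dots> = \<tau> * ((\<rho> / \<bar>s\<bar>) * (\<bar>s\<bar> / \<rho>)) ^ p" by (simp only: power_mult_distrib mult_ac)
        also have "(\<rho> / \<bar>s\<bar>) * (\<bar>s\<bar> / \<rho>) = 1" using \<rho> s0 by simp
        finally show ?thesis by simp
      qed
      ultimately have "norm (E v) \<le> (real p * K / \<bar>s\<bar> + (\<rho> / \<bar>s\<bar>) ^ p * m s) * norm v"
        and "real p * K / \<bar>s\<bar> + (\<rho> / \<bar>s\<bar>) ^ p * m s \<le> B" by (auto simp: B_def algebra_simps)
      then show ?thesis by (meson mult_right_mono norm_ge_zero order_trans)
    qed
    have E_power: "(E ^^ k) v = (res ?w ^^ k) ((J \<rho> ^^ (k * p)) v)" for k v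
    proof (induction k)
      case (Suc k)
      have "(J \<rho> ^^ p) ((res ?w ^^ k) ((J \<rho> ^^ (k * p)) v)) = (res ?w ^^ k) ((J \<rho> ^^ p) ((J \<rho> ^^ (k * p)) v))"
        using \<rho> by (intro funpow_commute_elem) (simp add: J_res_commute)
      then show ?case by (simp add: Suc E_def[of "(res ?w ^^ k) ((J \<rho> ^^ (k * p)) v)"] funpow_add)
    qed simp
    have J0: "(J \<rho> ^^ k) (res 0 v) = res 0 ((J \<rho> ^^ k) v)" for k v
      using funpow_commute_elem[of "J \<rho>" "res 0" k 1 v] \<rho> by (simp add: J_res_commute)
    have "norm ((res ?w ^^ n) (res 0 u)) = norm ((E ^^ n) (res 0 y))"
      by (simp add: E_power u_def q_def J0)
    also have "\<dots> = norm ((E ^^ n') (E (res 0 y)))" by (simp add: n' funpow_swap1)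
    also have "\<dots> \<le> B ^ n' * norm (E (res 0 y))" using EB B1 by (intro funpow_bound) auto
    also have "\<dots> \<le> B ^ n' * ((m0 * norm ((J \<rho> ^^ p) y) + norm (E y)) / \<bar>s\<bar>)"
      unfolding E_def J0 using B1 by (intro mult_left_mono res_inverse_gain[OF m m0] s0) auto
    also have "\<dots> \<le> B ^ n' * ((m0 * K + 1) * B * norm y / \<rho>)"
    proof -
      have "m0 * norm ((J \<rho> ^^ p) y) \<le> m0 * (K * norm y)"
        by (intro mult_left_mono J_power_bound \<rho> m0_nonneg)
      also have "\<dots> \<le> m0 * (K * norm y) * B"
        using mult_left_mono[OF B1, of "m0 * (K * norm y)"] m0_nonneg K_ge_1 by simp
      finally have "m0 * norm ((J \<rho> ^^ p) y) + norm (E y) \<le> (m0 * K + 1) * B * norm y"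
        using EB[of y] by (simp add: algebra_simps)
      then have "(m0 * norm ((J \<rho> ^^ p) y) + norm (E y)) / \<bar>s\<bar> \<le> (m0 * K + 1) * B * norm y / \<rho>"
        using 3 \<rho> B1 m0_nonneg K_ge_1 by (intro frac_le) auto
      then show ?thesis using B1 by (intro mult_left_mono) auto
    qed
    also have "\<dots> = C3 * \<tau> ^ n / \<rho> * norm y"
      by (simp add: C3_def n' B_def power_mult_distrib)
    also note goal_le[OF C(3)]
    finally show ?thesis by (simp add: smoothed_inverse_def u_def q_def)
  qed
qed

end

section \<open>Decay of the powers of a resolvent\<close>

text \<open>The left-hand side times \<open>(1 - q)\<^sup>j\<close> is one term of the binomial expansion of
  \<open>(q + (1 - q))\<^bsup>k + j\<^esup> = 1\<close>.\<close>

lemma binomial_power_bound: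
  fixes q :: real
  assumes q: "0 < q" "q < 1"
  shows "real ((k + j) choose j) * q ^ k \<le> 1 / (1 - q) ^ j"
proof -
  have "real ((k + j) choose k) * q ^ k * (1 - q) ^ (k + j - k) \<le> (\<Sum>i\<le>k + j. real ((k + j) choose i) * q ^ i * (1 - q) ^ (k + j - i))"
    using q by (intro member_le_sum) auto
  also have "\<dots> = (q + (1 - q)) ^ (k + j)" by (rule binomial_ring[symmetric])
  finally have "real ((k + j) choose k) * q ^ k * (1 - q) ^ j \<le> 1" by simp
  moreover have "(k + j) choose k = (k + j) choose j"
    using binomial_symmetric[of k "k + j"] by simp
  ultimately show ?thesis using q by (simp add: pos_le_divide_eq)
qed

lemma summable_binomial_power:
  fixes r :: real
  assumes r: "0 \<le> r" "r < 1"
  shows "summable (\<lambda>k. real ((k + j) choose j) * r ^ k)"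
proof -
  define q where "q = (1 + r) / 2"
  have q: "0 < q" "q < 1" "r < q" using r by (auto simp: q_def)
  have "summable (\<lambda>k. 1 / (1 - q) ^ j * (r / q) ^ k)"
    using q r by (intro summable_mult summable_geometric) auto
  then show ?thesis
  proof (rule summable_comparison_test')
    fix k :: nat
    have "real ((k + j) choose j) * r ^ k = (real ((k + j) choose j) * q ^ k) * (r / q) ^ k"
      using q by (simp add: power_divide)
    also have "\<dots> \<le> 1 / (1 - q) ^ j * (r / q) ^ k"
      using q r by (intro mult_right_mono binomial_power_bound) auto
    finally show "norm (real ((k + j) choose j) * r ^ k) \<le> 1 / (1 - q) ^ j * (r / q) ^ k"
      using r by simp
  qed
qed

context bounded_semigroup
begin

text \<open>The series of \<open>(1 - \<zeta> J \<mu>)\<^bsup>- j - 1\<^esup> y\<close>.\<close>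

definition binomial_series :: "real \<Rightarrow> complex \<Rightarrow> nat \<Rightarrow> 'a \<Rightarrow> 'a" where
  "binomial_series \<mu> \<zeta> j y = (\<Sum>k. (of_nat ((k + j) choose j) * \<zeta> ^ k) *\<^sub>C (J \<mu> ^^ k) y)"

lemma norm_binomial_term:
  assumes "\<mu> > 0"
  shows "norm ((of_nat ((k + j) choose j) * \<zeta> ^ k) *\<^sub>C (J \<mu> ^^ k) y)
    \<le> K * norm y * (real ((k + j) choose j) * cmod \<zeta> ^ k)"
  using mult_left_mono[OF J_power_bound[OF assms, of k y], of "real ((k + j) choose j) * cmod \<zeta> ^ k"]
  by (simp add: norm_scaleC norm_mult norm_power mult_ac)

lemma summable_norm_binomial_series:
  assumes "\<mu> > 0" "cmod \<zeta> < 1"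
  shows "summable (\<lambda>k. norm ((of_nat ((k + j) choose j) * \<zeta> ^ k) *\<^sub>C (J \<mu> ^^ k) y))"
  by (rule summable_comparison_test'[OF summable_mult[OF summable_binomial_power[of "cmod \<zeta>" j]]])
    (use assms norm_binomial_term in auto)

lemmas summable_binomial_series = summable_norm_cancel[OF summable_norm_binomial_series]

lemma binomial_series_commute:
  assumes \<mu>: "\<mu> > 0" and \<zeta>: "cmod \<zeta> < 1" and L: "bounded_linear L"
    and Lc: "\<And>c x. L (c *\<^sub>C x) = c *\<^sub>C L x" and LJ: "\<And>x. L (J \<mu> x) = J \<mu> (L x)"
  shows "L (binomial_series \<mu> \<zeta> j y) = binomial_series \<mu> \<zeta> j (L y)"
  unfolding binomial_series_def
  using bounded_linear.suminf[OF L summable_binomial_series[OF \<mu> \<zeta>, of j y]]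
    funpow_commute_elem[of L "J \<mu>" 1, OF LJ]
  by (simp add: Lc)

text \<open>Pascal's rule, read as multiplication by \<open>1 - \<zeta> J \<mu>\<close>.\<close>

lemma binomial_series_Suc:
  assumes \<mu>: "\<mu> > 0" and \<zeta>: "cmod \<zeta> < 1"
  shows "binomial_series \<mu> \<zeta> (Suc j) y - \<zeta> *\<^sub>C J \<mu> (binomial_series \<mu> \<zeta> (Suc j) y) = binomial_series \<mu> \<zeta> j y"
proof -
  define g where "g j k = (of_nat ((k + j) choose j) * \<zeta> ^ k) *\<^sub>C (J \<mu> ^^ k) y" for j k
  have sg: "summable (g j)" for j
    unfolding g_def by (rule summable_binomial_series[OF \<mu> \<zeta>])
  have F: "binomial_series \<mu> \<zeta> j y = (\<Sum>k. g j k)" for j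
    by (simp add: binomial_series_def g_def)
  have shift: "summable (\<lambda>k. g j (Suc k))" for j using sg by (simp add: summable_Suc_iff)
  have bl: "bounded_linear (\<lambda>x. \<zeta> *\<^sub>C J \<mu> x)"
    by (rule bounded_linear_compose[OF bounded_linear_scaleC J_linear[OF \<mu>]])
  have "\<zeta> *\<^sub>C J \<mu> (\<Sum>k. g (Suc j) k) = (\<Sum>k. \<zeta> *\<^sub>C J \<mu> (g (Suc j) k))"
    by (rule bounded_linear.suminf[OF bl sg])
  then have "(\<Sum>k. g (Suc j) k) - \<zeta> *\<^sub>C J \<mu> (\<Sum>k. g (Suc j) k)
      = g (Suc j) 0 + ((\<Sum>k. g (Suc j) (Suc k)) - (\<Sum>k. \<zeta> *\<^sub>C J \<mu> (g (Suc j) k)))"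
    using suminf_split_head[OF sg[of "Suc j"]] by simp
  also have "(\<Sum>k. g (Suc j) (Suc k)) - (\<Sum>k. \<zeta> *\<^sub>C J \<mu> (g (Suc j) k))
      = (\<Sum>k. g (Suc j) (Suc k) - \<zeta> *\<^sub>C J \<mu> (g (Suc j) k))"
    by (rule suminf_diff[OF shift bounded_linear.summable[OF bl sg]])
  also have "(\<lambda>k. g (Suc j) (Suc k) - \<zeta> *\<^sub>C J \<mu> (g (Suc j) k)) = (\<lambda>k. g j (Suc k))"
  proof
    fix k
    have "\<zeta> *\<^sub>C J \<mu> (g (Suc j) k) = (of_nat ((k + Suc j) choose Suc j) * \<zeta> ^ Suc k) *\<^sub>C (J \<mu> ^^ Suc k) y"
      by (simp add: g_def J_scaleC \<mu> scaleC_scaleC mult_ac)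
    then have "g (Suc j) (Suc k) - \<zeta> *\<^sub>C J \<mu> (g (Suc j) k)
        = ((of_nat ((Suc k + Suc j) choose Suc j) - of_nat ((k + Suc j) choose Suc j)) * \<zeta> ^ Suc k) *\<^sub>C (J \<mu> ^^ Suc k) y"
      unfolding g_def by (simp only: scaleC_diff_left left_diff_distrib)
    also have "(of_nat ((Suc k + Suc j) choose Suc j) - of_nat ((k + Suc j) choose Suc j) :: complex) = of_nat ((Suc k + j) choose j)"
      by simp
    finally show "g (Suc j) (Suc k) - \<zeta> *\<^sub>C J \<mu> (g (Suc j) k) = g j (Suc k)"
      by (simp add: g_def)
  qed
  also have "g (Suc j) 0 + (\<Sum>k. g j (Suc k)) = (\<Sum>k. g j k)"
  proof -
    have "g (Suc j) 0 = g j 0" by (simp add: g_def)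
    then show ?thesis using suminf_split_head[OF sg[of j]] by simp
  qed
  finally show ?thesis by (simp only: F)
qed

text \<open>The resolvent of the Euler step is exactly a resolvent of \<open>-A\<close>: with \<open>V = J \<mu>\<close> the operator
  \<open>V (1 - \<zeta> V)\<inverse>\<close> equals \<open>\<mu> (w + A)\<inverse>\<close> for \<open>w = \<mu> (1 - \<zeta>)\<close>, and \<open>w\<close> lies in the right half-plane
  when \<open>\<bar>\<zeta>\<bar> < 1\<close>. This makes implicit Euler steps preferable to the operators \<open>T h\<close>.\<close>

lemma J_binomial_series:
  assumes \<mu>: "\<mu> > 0" and \<zeta>: "cmod \<zeta> < 1"
  shows "J \<mu> (binomial_series \<mu> \<zeta> (Suc j) y)
    = complex_of_real \<mu> *\<^sub>C res (complex_of_real \<mu> * (1 - \<zeta>)) (binomial_series \<mu> \<zeta> j y)"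
proof -
  define u where "u = binomial_series \<mu> \<zeta> (Suc j) y"
  have w: "Re (complex_of_real \<mu> * (1 - \<zeta>)) \<ge> 0"
    using complex_Re_le_cmod[of \<zeta>] \<mu> \<zeta> by simp
  have "res (complex_of_real \<mu> * (1 - \<zeta>)) (complex_of_real \<mu> *\<^sub>C (u - \<zeta> *\<^sub>C J \<mu> u)) = J \<mu> u"
    by (rule res_eqI[OF w J_in_D[OF \<mu>]])
      (simp add: A_J[OF \<mu>] scaleR_scaleC scaleC_diff_right scaleC_diff_left right_diff_distrib scaleC_scaleC)
  then show ?thesis
    using binomial_series_Suc[OF \<mu> \<zeta>, of j y] w by (simp add: u_def res_scaleC)
qed

lemma J_power_binomial_series:
  assumes \<mu>: "\<mu> > 0" and \<zeta>: "cmod \<zeta> < 1"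
  shows "(J \<mu> ^^ j) (binomial_series \<mu> \<zeta> j y)
    = (complex_of_real \<mu> ^ j) *\<^sub>C (res (complex_of_real \<mu> * (1 - \<zeta>)) ^^ j) (binomial_series \<mu> \<zeta> 0 y)"
proof (induction j)
  case (Suc j)
  let ?w = "complex_of_real \<mu> * (1 - \<zeta>)"
  have w: "Re ?w \<ge> 0"
    using complex_Re_le_cmod[of \<zeta>] \<mu> \<zeta> by simp
  have "(J \<mu> ^^ Suc j) (binomial_series \<mu> \<zeta> (Suc j) y) = (J \<mu> ^^ j) (complex_of_real \<mu> *\<^sub>C res ?w (binomial_series \<mu> \<zeta> j y))"
    unfolding J_binomial_series[OF \<mu> \<zeta>, symmetric] by (simp add: funpow_swap1)
  also have "\<dots> = (J \<mu> ^^ j) (res ?w (complex_of_real \<mu> *\<^sub>C binomial_series \<mu> \<zeta> j y))"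
    using w by (simp add: res_scaleC)
  also have "\<dots> = res ?w ((J \<mu> ^^ j) (complex_of_real \<mu> *\<^sub>C binomial_series \<mu> \<zeta> j y))"
    using funpow_commute_elem[of "J \<mu>" "res ?w" j 1] w \<mu> by (simp add: J_res_commute)
  also have "(J \<mu> ^^ j) (complex_of_real \<mu> *\<^sub>C binomial_series \<mu> \<zeta> j y) = complex_of_real \<mu> *\<^sub>C (J \<mu> ^^ j) (binomial_series \<mu> \<zeta> j y)"
    using funpow_commute_elem[of "J \<mu>" "\<lambda>x. complex_of_real \<mu> *\<^sub>C x" j 1] \<mu> by (simp add: J_scaleC)
  finally show ?case using w by (simp add: Suc res_scaleC scaleC_scaleC)
qed simp

text \<open>The quantitative core. Let \<open>V = J \<mu>\<close>. The Fourier series with coefficients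
  \<open>r\<^sup>k V\<^sup>k x\<close> is turned, at each point \<open>\<omega>\<close> of the circle, by the operator \<open>(\<mu> (w + A)\<inverse>)\<^sup>n L\<close>
  with \<open>w = \<mu> (1 - r \<omega>)\<close>, of norm at most \<open>\<mu>\<^sup>n (1 + K)\<^sup>n N\<close>, into the one with
  coefficients \<open>r\<^sup>k (k + n choose n) V\<^bsup>k + n\<^esup> L x\<close>. By Plancherel the squared norms of the latter sum
  to at most \<open>8 m (K \<parallel>x\<parallel>)\<^sup>2\<close> times the square of that norm. For the \<open>m\<close> indices from \<open>m\<close> to \<open>2 m - 1\<close> the
  binomial coefficient is at least \<open>(m / n)\<^sup>n\<close>; power boundedness of \<open>V\<close> then transfers the average
  bound to the single power \<open>V\<^bsup>3 m\<^esup>\<close>.\<close>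

lemma J_power_decay:
  fixes m n :: nat
  assumes \<mu>: "\<mu> > 0" and L: "bounded_linear L" and Lc: "\<And>c x. L (c *\<^sub>C x) = c *\<^sub>C L x"
    and LJ: "\<And>x. L (J \<mu> x) = J \<mu> (L x)" and N: "N \<ge> 0"
    and bound: "\<And>s y. norm ((res (\<i> * complex_of_real s) ^^ n) (L y)) \<le> N * norm y"
    and mn: "1 \<le> n" "n \<le> m"
  shows "norm ((J \<mu> ^^ (3 * m)) (L x)) \<le> 4 * K\<^sup>2 * (real n * \<mu> / real m) ^ n * ((1 + K) ^ n * N) * norm x"
proof -
  have m: "real m > 0" "real m \<ge> 1" "real n > 0" using mn by auto
  \<comment> \<open>Close enough to \<open>1\<close> that \<open>r\<^bsup>4 m\<^esup> \<ge> 1 / 2\<close> by Bernoulli's inequality, far enough that \<open>1 / (1 - r) = 8 m\<close>.\<close>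
  define r where "r = 1 - 1 / (8 * real m)"
  have r: "0 < r" "r < 1" using m by (auto simp: r_def field_simps)
  define a where "a k = complex_of_real (r ^ k) *\<^sub>C (J \<mu> ^^ k) x" for k
  define b where "b k = complex_of_real (r ^ k * real ((k + n) choose n)) *\<^sub>C (J \<mu> ^^ (k + n)) (L x)" for k
  define B where "B = \<mu> ^ n * ((1 + K) ^ n * N)"
  have B: "B \<ge> 0" using \<mu> K_ge_1 N by (simp add: B_def)
  have norm_a: "norm (a k) \<le> K * norm x * r ^ k" for k
    using norm_binomial_term[OF \<mu>, of k 0 "complex_of_real r" x] r by (simp add: a_def)
  have norm_b: "norm (b k) \<le> K * norm (L x) * (real ((k + n) choose n) * r ^ k)" for k
  proof -
    have "norm (b k) = r ^ k * real ((k + n) choose n) * norm ((J \<mu> ^^ (k + n)) (L x))"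
      using r by (simp add: b_def norm_scaleC norm_mult norm_power)
    also have "\<dots> \<le> r ^ k * real ((k + n) choose n) * (K * norm (L x))"
      using r by (intro mult_left_mono J_power_bound \<mu>) auto
    finally show ?thesis by (simp add: mult_ac)
  qed
  have geo: "summable (\<lambda>k. r ^ k)" using r by (intro summable_geometric) auto
  have a: "summable (\<lambda>k. norm (a k))"
    by (rule summable_comparison_test'[OF summable_mult[OF geo]]) (use norm_a in auto)
  have b: "summable (\<lambda>k. norm (b k))"
    by (rule summable_comparison_test'[OF summable_mult[OF summable_binomial_power[of r n]]]) (use r norm_b in auto)
  have square: "(norm (a k))\<^sup>2 \<le> (K * norm x)\<^sup>2 * r ^ k" for k
  proof -
    have "(norm (a k))\<^sup>2 \<le> (K * norm x * r ^ k)\<^sup>2" using norm_a by (intro power_mono) auto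
    also have "\<dots> = (K * norm x)\<^sup>2 * (r ^ k * r ^ k)" by (simp add: power2_eq_square)
    also have "\<dots> \<le> (K * norm x)\<^sup>2 * (r ^ k * 1)"
      using r by (intro mult_left_mono power_le_one) auto
    finally show ?thesis by simp
  qed
  have a2: "summable (\<lambda>k. (norm (a k))\<^sup>2)"
    by (rule summable_comparison_test'[OF summable_mult[OF geo]]) (use square in auto)
  have "(\<Sum>k. (norm (a k))\<^sup>2) \<le> (\<Sum>k. (K * norm x)\<^sup>2 * r ^ k)"
    by (rule suminf_le[OF square a2 summable_mult[OF geo]])
  also have "\<dots> = (K * norm x)\<^sup>2 * (1 / (1 - r))"
    using r by (simp add: suminf_mult[OF geo] suminf_geometric)
  also have "1 / (1 - r) = 8 * real m" using m by (simp add: r_def)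
  finally have sum_a: "(\<Sum>k. (norm (a k))\<^sup>2) \<le> (K * norm x)\<^sup>2 * (8 * real m)" .
  have multiplier: "norm (\<Sum>k. \<omega> ^ k *\<^sub>C b k) \<le> B * norm (\<Sum>k. \<omega> ^ k *\<^sub>C a k)" if \<omega>: "cmod \<omega> = 1" for \<omega>
  proof -
    define \<zeta> where "\<zeta> = complex_of_real r * \<omega>"
    define w where "w = complex_of_real \<mu> * (1 - \<zeta>)"
    have \<zeta>: "cmod \<zeta> < 1" using r \<omega> by (simp add: \<zeta>_def norm_mult)
    have w: "Re w \<ge> 0" using complex_Re_le_cmod[of \<zeta>] \<mu> \<zeta> by (simp add: w_def)
    have "(\<Sum>k. \<omega> ^ k *\<^sub>C b k) = (\<Sum>k. (J \<mu> ^^ n) ((of_nat ((k + n) choose n) * \<zeta> ^ k) *\<^sub>C (J \<mu> ^^ k) (L x)))"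
    proof (rule suminf_cong)
      fix k
      have "(J \<mu> ^^ n) ((of_nat ((k + n) choose n) * \<zeta> ^ k) *\<^sub>C (J \<mu> ^^ k) (L x))
          = (of_nat ((k + n) choose n) * \<zeta> ^ k) *\<^sub>C (J \<mu> ^^ n) ((J \<mu> ^^ k) (L x))"
        using funpow_commute_elem[of "J \<mu>" "\<lambda>x. (of_nat ((k + n) choose n) * \<zeta> ^ k) *\<^sub>C x" n 1] \<mu> by (simp add: J_scaleC)
      also have "(J \<mu> ^^ n) ((J \<mu> ^^ k) (L x)) = (J \<mu> ^^ (k + n)) (L x)"
        by (simp add: add.commute[of k] funpow_add)
      finally show "\<omega> ^ k *\<^sub>C b k = (J \<mu> ^^ n) ((of_nat ((k + n) choose n) * \<zeta> ^ k) *\<^sub>C (J \<mu> ^^ k) (L x))"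
        by (simp add: b_def \<zeta>_def scaleC_scaleC power_mult_distrib mult_ac)
    qed
    also have "\<dots> = (J \<mu> ^^ n) (binomial_series \<mu> \<zeta> n (L x))"
      unfolding binomial_series_def
      by (rule bounded_linear.suminf[OF bounded_linear_funpow[OF J_linear[OF \<mu>]] summable_binomial_series[OF \<mu> \<zeta>], symmetric])
    also have "\<dots> = (complex_of_real \<mu> ^ n) *\<^sub>C (res w ^^ n) (L (binomial_series \<mu> \<zeta> 0 x))"
      unfolding J_power_binomial_series[OF \<mu> \<zeta>] w_def
      by (simp add: binomial_series_commute[OF \<mu> \<zeta> L Lc LJ])
    finally have "norm (\<Sum>k. \<omega> ^ k *\<^sub>C b k) = \<mu> ^ n * norm ((res w ^^ n) (L (binomial_series \<mu> \<zeta> 0 x)))"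
      using \<mu> by (simp add: norm_scaleC norm_power)
    also have "\<dots> \<le> \<mu> ^ n * ((1 + K) ^ n * (N * norm (binomial_series \<mu> \<zeta> 0 x)))"
    proof -
      have "norm ((res w ^^ n) v) \<le> (1 + K) ^ n * norm ((res (\<i> * complex_of_real (Im w)) ^^ n) v)" for v
        using res_power_half_plane[OF w, where s = "Im w" and n = n and y = v] by (simp add: complex_eq[symmetric])
      then show ?thesis
        using \<mu> K_ge_1 by (intro mult_left_mono order_trans[OF _ mult_left_mono[OF bound]]) auto
    qed
    also have "binomial_series \<mu> \<zeta> 0 x = (\<Sum>k. \<omega> ^ k *\<^sub>C a k)"
      by (simp add: binomial_series_def a_def \<zeta>_def scaleC_scaleC power_mult_distrib mult_ac)
    finally show ?thesis by (simp add: B_def mult_ac)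
  qed
  \<comment> \<open>up to a factor \<open>2\<close>, \<open>d\<^sup>2\<close> is a lower bound of the \<open>m\<close> squared coefficients with index in \<open>[m, 2 m)\<close>\<close>
  define d where "d = (real m / real n) ^ n * norm ((J \<mu> ^^ (3 * m)) (L x)) / K"
  have d0: "d \<ge> 0" using K_ge_1 by (simp add: d_def)
  have lower: "d\<^sup>2 / 2 \<le> (norm (b k))\<^sup>2" if k: "m \<le> k" "k < 2 * m" for k
  proof -
    have "1 / 2 \<le> 1 + real (4 * m) * (- (1 / (8 * real m)))" using m by simp
    also have "\<dots> \<le> (1 + - (1 / (8 * real m))) ^ (4 * m)"
      using m by (intro Bernoulli_inequality) (simp add: field_simps)
    also have "\<dots> = r ^ (4 * m)" by (simp add: r_def)
    also have "\<dots> \<le> r ^ (2 * k)" using r k by (intro power_decreasing) auto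
    finally have rk: "1 / 2 \<le> (r ^ k)\<^sup>2" by (simp add: power_mult[symmetric] mult.commute)
    have "(real m / real n) ^ n \<le> (real (k + n) / real n) ^ n"
      using m k by (intro power_mono divide_right_mono) auto
    also have "\<dots> \<le> real ((k + n) choose n)" by (rule binomial_ge_n_over_k_pow_k) simp
    finally have ch: "(real m / real n) ^ n \<le> real ((k + n) choose n)" .
    have "norm ((J \<mu> ^^ (3 * m)) (L x)) = norm ((J \<mu> ^^ (3 * m - (k + n))) ((J \<mu> ^^ (k + n)) (L x)))"
      using k mn by (simp flip: funpow_add[THEN fun_cong, unfolded o_apply])
    also have "\<dots> \<le> K * norm ((J \<mu> ^^ (k + n)) (L x))" by (rule J_power_bound[OF \<mu>])
    finally have "norm ((J \<mu> ^^ (3 * m)) (L x)) / K \<le> norm ((J \<mu> ^^ (k + n)) (L x))"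
      using K_ge_1 by (simp add: pos_divide_le_eq mult.commute)
    then have "d \<le> real ((k + n) choose n) * norm ((J \<mu> ^^ (k + n)) (L x))"
      unfolding d_def times_divide_eq_right[symmetric] using K_ge_1 by (intro mult_mono ch) auto
    then have "d\<^sup>2 \<le> (real ((k + n) choose n) * norm ((J \<mu> ^^ (k + n)) (L x)))\<^sup>2"
      using d0 by (intro power_mono) auto
    then have "1 / 2 * d\<^sup>2 \<le> (r ^ k)\<^sup>2 * (real ((k + n) choose n) * norm ((J \<mu> ^^ (k + n)) (L x)))\<^sup>2"
      by (intro mult_mono rk) auto
    also have "\<dots> = (norm (b k))\<^sup>2"
      using r by (simp add: b_def norm_scaleC norm_mult norm_power power_mult_distrib)
    finally show ?thesis by simp
  qed
  have "real m * (d\<^sup>2 / 2) = (\<Sum>k\<in>{m..<2 * m}. d\<^sup>2 / 2)" by simp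
  also have "\<dots> \<le> (\<Sum>k\<in>{m..<2 * m}. (norm (b k))\<^sup>2)" by (rule sum_mono) (use lower in auto)
  also have "\<dots> \<le> (\<Sum>k<2 * m. (norm (b k))\<^sup>2)" by (rule sum_mono2) auto
  also have "\<dots> \<le> B\<^sup>2 * (\<Sum>k. (norm (a k))\<^sup>2)"
    by (rule Plancherel_multiplier[OF a b B multiplier a2])
  also have "\<dots> \<le> B\<^sup>2 * ((K * norm x)\<^sup>2 * (8 * real m))" by (intro mult_left_mono sum_a) auto
  also have "\<dots> = real m * ((4 * B * (K * norm x))\<^sup>2 / 2)" by (simp add: power_mult_distrib)
  finally have "d\<^sup>2 \<le> (4 * B * (K * norm x))\<^sup>2" using m by simp
  then have "d \<le> 4 * B * (K * norm x)"
    by (rule power2_le_imp_le) (use B K_ge_1 in auto)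
  then have "(real m / real n) ^ n * norm ((J \<mu> ^^ (3 * m)) (L x)) \<le> 4 * B * (K * norm x) * K"
    using K_ge_1 by (simp add: d_def pos_divide_le_eq)
  then have "(real n / real m) ^ n * ((real m / real n) ^ n * norm ((J \<mu> ^^ (3 * m)) (L x)))
      \<le> (real n / real m) ^ n * (4 * B * (K * norm x) * K)"
    using m by (intro mult_left_mono) auto
  moreover have "(real n / real m) ^ n * (real m / real n) ^ n = 1"
    using m by (simp flip: power_mult_distrib)
  ultimately have "norm ((J \<mu> ^^ (3 * m)) (L x)) \<le> (real n / real m) ^ n * (4 * B * (K * norm x) * K)"
    by (simp only: mult.assoc[symmetric])
  also have "\<dots> = 4 * K\<^sup>2 * (real n * \<mu> / real m) ^ n * ((1 + K) ^ n * N) * norm x"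
    by (simp add: B_def power_mult_distrib power_divide power2_eq_square mult_ac)
  finally show ?thesis .
qed

end

section \<open>From the resolvent to the semigroup\<close>

context bounded_semigroup
begin

lemma A_J_commute: "\<rho> > 0 \<Longrightarrow> z \<in> D \<Longrightarrow> A (J \<rho> z) = J \<rho> (A z)"
  using A_commuting[OF J_linear, of \<rho> z] by (simp add: J_T_commute)

lemma J_minus_id:
  assumes "\<rho> > 0" "z \<in> D"
  shows "J \<rho> z - z = - ((1 / \<rho>) *\<^sub>R J \<rho> (A z))"
proof -
  have "J \<rho> (A z) = \<rho> *\<^sub>R (z - J \<rho> z)" using A_J A_J_commute assms by metis
  then show ?thesis using assms by simp
qed

text \<open>Replace the factors \<open>T h\<close> by \<open>J \<rho>\<close> one at a time; both have bounded powers. The leading \<open>T s\<close>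
  carries the accumulated factors \<open>T h\<close> through the induction without accumulating powers of \<open>K\<close>.\<close>

lemma telescope:
  assumes h: "h > 0" and \<rho>: "\<rho> > 0" and s: "s \<ge> 0"
  shows "norm (T s ((J \<rho> ^^ j) z - T (real j * h) z)) \<le> real j * (K\<^sup>2 * norm (J \<rho> z - T h z))"
  using s
proof (induction j arbitrary: s)
  case 0
  then show ?case using linear_0[OF bounded_linear.linear[OF T_linear]] by (simp add: T_0)
next
  case (Suc j)
  have step: "(J \<rho> ^^ j) (T h z) = T h ((J \<rho> ^^ j) z)"
    using funpow_commute_elem[of "J \<rho>" "T h" j 1 z] h \<rho> by (simp add: J_T_commute)
  have shift: "T s (T h v) = T (s + h) v" for v
    using T_add[of s h] h Suc.prems by simp
  have "real (Suc j) * h = h + real j * h" by (simp add: algebra_simps)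
  moreover have "T (h + real j * h) z = T h (T (real j * h) z)"
    using T_add[of h "real j * h"] h by simp
  ultimately have split: "T (real (Suc j) * h) z = T h (T (real j * h) z)"
    by (simp only:)
  have lin: "(J \<rho> ^^ j) (J \<rho> z - T h z) = (J \<rho> ^^ j) (J \<rho> z) - (J \<rho> ^^ j) (T h z)"
    using linear_diff[OF bounded_linear.linear[OF bounded_linear_funpow[OF J_linear[OF \<rho>]]]] .
  have "(J \<rho> ^^ Suc j) z - T (real (Suc j) * h) z
      = (J \<rho> ^^ j) (J \<rho> z - T h z) + T h ((J \<rho> ^^ j) z - T (real j * h) z)"
    unfolding lin step split using h by (simp add: funpow_swap1 T_diff)
  then have "T s ((J \<rho> ^^ Suc j) z - T (real (Suc j) * h) z)
      = T s ((J \<rho> ^^ j) (J \<rho> z - T h z)) + T (s + h) ((J \<rho> ^^ j) z - T (real j * h) z)"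
    using Suc.prems by (simp only: T_plus shift)
  then have "norm (T s ((J \<rho> ^^ Suc j) z - T (real (Suc j) * h) z))
      \<le> norm (T s ((J \<rho> ^^ j) (J \<rho> z - T h z))) + norm (T (s + h) ((J \<rho> ^^ j) z - T (real j * h) z))"
    by (simp only: norm_triangle_ineq)
  also have "\<dots> \<le> K * (K * norm (J \<rho> z - T h z)) + real j * (K\<^sup>2 * norm (J \<rho> z - T h z))"
  proof (rule add_mono)
    have "norm (T s ((J \<rho> ^^ j) (J \<rho> z - T h z))) \<le> K * norm ((J \<rho> ^^ j) (J \<rho> z - T h z))"
      using Suc.prems by (rule T_bound)
    also have "\<dots> \<le> K * (K * norm (J \<rho> z - T h z))"
      using K_ge_1 by (intro mult_left_mono J_power_bound \<rho>) auto
    finally show "norm (T s ((J \<rho> ^^ j) (J \<rho> z - T h z))) \<le> K * (K * norm (J \<rho> z - T h z))" .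
  qed (use Suc h in auto)
  also have "\<dots> = real (Suc j) * (K\<^sup>2 * norm (J \<rho> z - T h z))"
    by (simp add: distrib_right power2_eq_square)
  finally show ?case .
qed

text \<open>Convergence of the implicit Euler scheme. The scheme is consistent at \<open>z\<close>, because
  \<open>(J \<rho> z - z) / h = - J \<rho> (A z)\<close> tends to \<open>- A z\<close> when \<open>A z\<close> is in the domain, and telescoping supplies
  stability.\<close>

lemma exponential_formula:
  assumes t: "t > 0" and z: "z \<in> D" and Az: "A z \<in> D"
  shows "(\<lambda>j. (J (real j / t) ^^ j) z) \<longlonglongrightarrow> T t z"
proof -
  define err where "err h = h * K * norm (A (A z)) + norm ((T h z - z) /\<^sub>R h - (- A z))" for h
  have err0: "(err \<longlongrightarrow> 0 * K * norm (A (A z)) + norm (0::'a)) (at_right 0)"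
    unfolding err_def
    by (intro tendsto_intros LIM_zero generator_tendsto z)
  have le: "norm ((J (real j / t) ^^ j) z - T t z) \<le> t * K\<^sup>2 * err (t / real j)" if j: "j > 0" for j
  proof -
    define h where "h = t / real j"
    define \<rho> where "\<rho> = real j / t"
    have h: "h > 0" "\<rho> > 0" "1 / \<rho> = h" "real j * h = t" using t j by (auto simp: h_def \<rho>_def)
    have "J \<rho> z - T h z = (J \<rho> z - z) - (T h z - z)" by simp
    also have "\<dots> = - (h *\<^sub>R ((J \<rho> (A z) - A z) + ((T h z - z) /\<^sub>R h - (- A z))))"
      unfolding J_minus_id[OF h(2) z] h(3) using h(1) by (simp add: algebra_simps)
    finally have "norm (J \<rho> z - T h z) = h * norm ((J \<rho> (A z) - A z) + ((T h z - z) /\<^sub>R h - (- A z)))"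
      using h(1) by simp
    also have "\<dots> \<le> h * (norm (J \<rho> (A z) - A z) + norm ((T h z - z) /\<^sub>R h - (- A z)))"
      using h(1) by (intro mult_left_mono norm_triangle_ineq) auto
    also have "norm (J \<rho> (A z) - A z) = h * norm (J \<rho> (A (A z)))"
      unfolding J_minus_id[OF h(2) Az] h(3) using h(1) by simp
    also have "h * (h * norm (J \<rho> (A (A z))) + norm ((T h z - z) /\<^sub>R h - (- A z))) \<le> h * err h"
      unfolding err_def mult.assoc using h by (intro mult_left_mono add_mono J_bound order_refl) auto
    finally have e: "norm (J \<rho> z - T h z) \<le> h * err h" .
    have "norm ((J \<rho> ^^ j) z - T t z) \<le> real j * (K\<^sup>2 * norm (J \<rho> z - T h z))"
      using telescope[OF h(1,2), of 0 j z] h(4) by (simp add: T_0)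
    also have "\<dots> \<le> real j * (K\<^sup>2 * (h * err h))" by (intro mult_left_mono e) auto
    also have "\<dots> = (real j * h) * K\<^sup>2 * err h" by simp
    finally show ?thesis unfolding h(4) by (simp add: \<rho>_def h_def)
  qed
  have "filterlim (\<lambda>j. t / real j) (at_right 0) sequentially"
    unfolding filterlim_at
  proof
    show "(\<lambda>j. t / real j) \<longlonglongrightarrow> 0" by (rule lim_const_over_n)
    show "\<forall>\<^sub>F j in sequentially. t / real j \<in> {0<..} \<and> t / real j \<noteq> 0"
      using eventually_gt_at_top[of 0] by eventually_elim (use t in auto)
  qed
  from filterlim_compose[OF err0 this]
  have "(\<lambda>j. t * K\<^sup>2 * err (t / real j)) \<longlonglongrightarrow> t * K\<^sup>2 * 0"
    by (intro tendsto_mult tendsto_const) simp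
  then have err_lim: "(\<lambda>j. t * K\<^sup>2 * err (t / real j)) \<longlonglongrightarrow> 0" by simp
  have "\<forall>\<^sub>F j in sequentially. norm ((J (real j / t) ^^ j) z - T t z) \<le> t * K\<^sup>2 * err (t / real j)"
    using eventually_gt_at_top[of 0] by eventually_elim (rule le)
  then have "(\<lambda>j. (J (real j / t) ^^ j) z - T t z) \<longlonglongrightarrow> 0"
    using err_lim by (rule Lim_null_comparison)
  then show ?thesis by (rule LIM_zero_cancel)
qed

lemma T_decay:
  fixes n :: nat
  assumes t: "t > 0" and L: "bounded_linear L" and Lc: "\<And>c x. L (c *\<^sub>C x) = c *\<^sub>C L x"
    and LJ: "\<And>\<mu> x. \<mu> > 0 \<Longrightarrow> L (J \<mu> x) = J \<mu> (L x)" and N: "N \<ge> 0"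
    and bound: "\<And>s y. norm ((res (\<i> * complex_of_real s) ^^ n) (L y)) \<le> N * norm y"
    and n: "n \<ge> 1" and D: "L x \<in> D" "A (L x) \<in> D"
  shows "norm (T t (L x)) \<le> 4 * K\<^sup>2 * (3 * real n / t) ^ n * ((1 + K) ^ n * N) * norm x"
proof (rule Lim_norm_ubound)
  show "(\<lambda>m. (J (real (3 * m) / t) ^^ (3 * m)) (L x)) \<longlonglongrightarrow> T t (L x)"
    by (rule filterlim_compose[OF exponential_formula[OF t D]])
      (rule filterlim_subseq, simp add: strict_mono_def)
  show "\<forall>\<^sub>F m in sequentially. norm ((J (real (3 * m) / t) ^^ (3 * m)) (L x))
      \<le> 4 * K\<^sup>2 * (3 * real n / t) ^ n * ((1 + K) ^ n * N) * norm x"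
    using eventually_ge_at_top[of n]
  proof eventually_elim
    case (elim m)
    then have m: "m > 0" using n by simp
    have rate: "real n * (real (3 * m) / t) / real m = 3 * real n / t" using m by simp
    have pos: "real (3 * m) / t > 0" using m t by simp
    show ?case
      using J_power_decay[OF pos L Lc LJ[OF pos] N bound n elim, of x] by (simp only: rate)
  qed
qed simp

text \<open>Split \<open>A\<inverse>\<close> at the frequency \<open>\<rho>\<close>. The high part is of order \<open>1 / \<rho>\<close>, and the smoothed part is as
  well, once \<open>t\<close> is comparable with \<open>\<tau>\<close>.\<close>

lemma T_inverse_bound:
  fixes m :: "real \<Rightarrow> real" and n p :: nat
  assumes m: "\<And>s y. norm (res (\<i> * complex_of_real s) y) \<le> m s * norm y"
    and m0: "\<And>y. norm (res 0 y) \<le> m0 * norm y" and m0_nonneg: "m0 \<ge> 0"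
    and s1: "s1 \<ge> 1" "s1 \<le> \<rho>" and n: "n \<ge> 1" "real n * \<beta> \<ge> 1" and c: "c \<ge> 0" and \<tau>: "\<tau> > 0"
    and low: "\<And>s. \<bar>s\<bar> \<le> s1 \<Longrightarrow> m s \<le> c"
    and mid: "\<And>s. s1 \<le> \<bar>s\<bar> \<Longrightarrow> \<bar>s\<bar> \<le> \<rho> \<Longrightarrow> max 1 (m s) \<le> \<tau> * (\<bar>s\<bar> / \<rho>) powr \<beta>"
    and high: "\<And>s. \<rho> \<le> \<bar>s\<bar> \<Longrightarrow> m s \<le> \<tau> * (\<bar>s\<bar> / \<rho>) ^ p"
    and p: "p \<ge> 1" and t: "t > 0"
  defines "C \<equiv> c ^ n * m0 * K * s1 + (m0 + 1) * K + (real p * K + 1) ^ n * (m0 * K + 1)"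
  shows "norm (T t (res 0 y)) \<le> (real (n * p) * K\<^sup>2 + 4 * K\<^sup>2 * (3 * real n * (1 + K) * (\<tau> / t)) ^ n * C) / \<rho> * norm y"
proof -
  define L where "L = smoothed_inverse \<rho> (n * p)"
  define N where "N = C * \<tau> ^ n / \<rho>"
  have \<rho>: "\<rho> > 0" using s1 by simp
  have C: "C \<ge> 0" using c m0_nonneg K_ge_1 s1 by (auto simp: C_def)
  obtain q where q: "n * p = Suc q" using n p by (cases "n * p") auto
  have 0: "norm (T t (L y)) \<le> 4 * K\<^sup>2 * (3 * real n / t) ^ n * ((1 + K) ^ n * N) * norm y"
  proof (rule T_decay[OF t])
    show "bounded_linear L"
      unfolding L_def smoothed_inverse_def
      by (intro bounded_linear_compose[OF res_linear] bounded_linear_funpow J_linear \<rho>) simp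
    show "L (c *\<^sub>C x) = c *\<^sub>C L x" for c x
      using funpow_commute_elem[of "J \<rho>" "\<lambda>x. c *\<^sub>C x" "n * p" 1 x] \<rho>
      by (simp add: L_def smoothed_inverse_def J_scaleC res_scaleC)
    show "L (J \<mu> x) = J \<mu> (L x)" if "\<mu> > 0" for \<mu> x
      using funpow_commute_elem[of "J \<rho>" "J \<mu>" "n * p" 1 x] \<rho> that
      by (simp add: L_def smoothed_inverse_def J_J_commute J_res_commute)
    show "N \<ge> 0" using C \<tau> \<rho> by (simp add: N_def)
    show "norm ((res (\<i> * complex_of_real s) ^^ n) (L y)) \<le> N * norm y" for s y
      unfolding L_def N_def C_def
      by (rule smoothed_resolvent_bound[OF m m0 m0_nonneg s1 n c \<tau> low mid high])
    show "L y \<in> D" by (simp add: L_def smoothed_inverse_def res_in_D)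
    \<comment> \<open>At least one factor \<open>J \<rho>\<close> is present, which puts \<open>A (L y)\<close> in the domain.\<close>
    have "A (L y) = (J \<rho> ^^ Suc q) y"
      by (simp add: L_def smoothed_inverse_def q A_res del: funpow.simps)
    then show "A (L y) \<in> D" by (simp add: J_in_D \<rho>)
  qed fact
  have rate: "(3 * real n / t) ^ n * (G ^ n * N) = (3 * real n * G * (\<tau> / t)) ^ n * C / \<rho>" for G
    by (simp add: N_def power_mult_distrib power_divide mult_ac)
  have "4 * K\<^sup>2 * (3 * real n / t) ^ n * ((1 + K) ^ n * N) * norm y
      = 4 * K\<^sup>2 * ((3 * real n / t) ^ n * ((1 + K) ^ n * N)) * norm y"
    by (simp only: mult.assoc)
  also have "\<dots> = 4 * K\<^sup>2 * (3 * real n * (1 + K) * (\<tau> / t)) ^ n * C / \<rho> * norm y"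
    unfolding rate by simp
  finally have 1: "norm (T t (L y)) \<le> 4 * K\<^sup>2 * (3 * real n * (1 + K) * (\<tau> / t)) ^ n * C / \<rho> * norm y"
    using 0 by simp
  have "norm (T t (res 0 y - L y)) \<le> K * norm (res 0 y - L y)" using t by (intro T_bound) simp
  also have "\<dots> \<le> K * (real (n * p) * K / \<rho> * norm y)"
    unfolding L_def smoothed_inverse_def
    using K_ge_1 by (intro mult_left_mono high_frequency_part \<rho>) auto
  finally have 2: "norm (T t (res 0 y - L y)) \<le> K * (real (n * p) * K / \<rho> * norm y)" .
  have "T t (res 0 y) = T t (res 0 y - L y) + T t (L y)" using t by (simp add: T_diff)
  then have "norm (T t (res 0 y)) \<le> norm (T t (res 0 y - L y)) + norm (T t (L y))"
    by (simp only: norm_triangle_ineq)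
  also note add_mono[OF 2 1]
  finally show ?thesis by (simp add: power2_eq_square add_divide_distrib algebra_simps)
qed

text \<open>By the resolvent identity a bound at \<open>i s\<close> doubles at most within distance \<open>1 / (2 m s)\<close>;
  finitely many such neighbourhoods cover the interval.\<close>

lemma imag_resolvent_bounded_on_compact:
  "\<exists>c\<ge>0. \<forall>s y. \<bar>s\<bar> \<le> s1 \<longrightarrow> norm (res (\<i> * complex_of_real s) y) \<le> c * norm y"
proof -
  have "\<forall>s. \<exists>m>0. \<forall>y. norm (res (\<i> * complex_of_real s) y) \<le> m * norm y"
    using imag_resolvent_bound by metis
  then obtain m where m0: "\<And>s. m s > 0" and m: "\<And>s y. norm (res (\<i> * complex_of_real s) y) \<le> m s * norm y"
    by metis
  have near: "norm (res (\<i> * complex_of_real s') y) \<le> 2 * m s * norm y"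
    if "s' \<in> ball s (1 / (2 * m s))" for s s' y
  proof -
    let ?w = "\<i> * complex_of_real s" and ?z = "\<i> * complex_of_real s'"
    have d: "\<bar>s - s'\<bar> * m s \<le> 1 / 2"
      using that m0[of s] by (simp add: dist_real_def pos_less_divide_eq)
    have "res ?z y = res ?w y + (?w - ?z) *\<^sub>C res ?w (res ?z y)"
      using res_identity[of ?z ?w y] res_commute[of ?z ?w y] by (simp add: algebra_simps)
    then have "norm (res ?z y) \<le> norm (res ?w y) + norm ((?w - ?z) *\<^sub>C res ?w (res ?z y))"
      by (metis norm_triangle_ineq)
    also have "?w - ?z = \<i> * complex_of_real (s - s')" by (simp add: algebra_simps)
    then have "norm ((?w - ?z) *\<^sub>C res ?w (res ?z y)) = \<bar>s - s'\<bar> * norm (res ?w (res ?z y))"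
      by (simp only: norm_scaleC norm_mult norm_of_real) simp
    also have "norm (res ?w y) + \<bar>s - s'\<bar> * norm (res ?w (res ?z y)) \<le> m s * norm y + \<bar>s - s'\<bar> * (m s * norm (res ?z y))"
      by (intro add_mono mult_left_mono m) auto
    also have "\<bar>s - s'\<bar> * (m s * norm (res ?z y)) \<le> 1 / 2 * norm (res ?z y)"
      using mult_right_mono[OF d norm_ge_zero[of "res ?z y"]] by (simp only: mult.assoc)
    finally show ?thesis by simp
  qed
  obtain F where F: "F \<subseteq> {- s1..s1}" "finite F" "{- s1..s1} \<subseteq> (\<Union>s\<in>F. ball s (1 / (2 * m s)))"
  proof (rule compactE_image[of "{- s1..s1}" "{- s1..s1}" "\<lambda>s. ball s (1 / (2 * m s))"])
    show "{- s1..s1} \<subseteq> (\<Union>s\<in>{- s1..s1}. ball s (1 / (2 * m s)))"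
      using m0 by (intro subsetI UN_I) auto
  qed (auto intro: that)
  define c where "c = (\<Sum>s\<in>F. 2 * m s)"
  have pos: "2 * m s \<ge> 0" for s using m0[of s] by simp
  have "norm (res (\<i> * complex_of_real s') y) \<le> c * norm y" if "\<bar>s'\<bar> \<le> s1" for s' y
  proof -
    have "s' \<in> {- s1..s1}" using that by auto
    then obtain s where s: "s \<in> F" "s' \<in> ball s (1 / (2 * m s))" using F(3) by blast
    have "2 * m s \<le> c" unfolding c_def using F(2) s(1) pos by (intro member_le_sum) auto
    then show ?thesis using near[OF s(2), of y] by (meson mult_right_mono norm_ge_zero order_trans)
  qed
  moreover have "c \<ge> 0" unfolding c_def by (intro sum_nonneg pos)
  ultimately show ?thesis by blast
qed

end

section \<open>Regular variation and the rate of decay\<close>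

text \<open>A Potter bound. Slow variation at the single ratio \<open>2\<close> bounds \<open>l\<close> along \<open>s, 2 s, 4 s, \<dots>\<close>, and
  monotonicity fills the gaps at the price of the factor \<open>2\<^sup>\<beta>\<close>.\<close>

lemma slowly_varying_mono_Potter:
  fixes \<beta> :: real
  assumes sv: "slowly_varying_on a l" and mono: "mono_on {a..} l" and \<beta>: "\<beta> > 0"
  obtains s0 where "s0 \<ge> 1" "s0 \<ge> a"
    "\<And>s \<rho>. s0 \<le> s \<Longrightarrow> s \<le> \<rho> \<Longrightarrow> l \<rho> \<le> 2 powr \<beta> * (\<rho> / s) powr \<beta> * l s"
proof -
  have "((\<lambda>s. if l (2 * s) = 0 \<and> l s = 0 then 1 else l (2 * s) / l s) \<longlongrightarrow> 1) at_top"
    using sv by (simp add: slowly_varying_on_def asymp_equiv_def)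
  moreover have "(1::real) < 2 powr \<beta>" using \<beta> by simp
  ultimately have "\<forall>\<^sub>F s in at_top. (if l (2 * s) = 0 \<and> l s = 0 then 1 else l (2 * s) / l s) < 2 powr \<beta>"
    by (rule order_tendstoD)
  then obtain s2 where s2: "\<And>s. s \<ge> s2 \<Longrightarrow> (if l (2 * s) = 0 \<and> l s = 0 then 1 else l (2 * s) / l s) < 2 powr \<beta>"
    by (auto simp: eventually_at_top_linorder)
  define s0 where "s0 = max (max 1 a) s2"
  have pos: "l s > 0" if "s \<ge> s0" for s using sv that by (auto simp: slowly_varying_on_def s0_def)
  have dbl: "l (2 * s) \<le> 2 powr \<beta> * l s" if "s \<ge> s0" for s
    using s2[of s] pos[OF that] that by (auto simp: s0_def pos_divide_less_eq split: if_splits)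
  have iter: "l (2 ^ k * s) \<le> (2 ^ k) powr \<beta> * l s" if s: "s \<ge> s0" for k :: nat and s
  proof (induction k)
    case (Suc k)
    have "s * 1 \<le> s * 2 ^ k" using s by (intro mult_left_mono) (auto simp: s0_def)
    then have "s0 \<le> 2 ^ k * s" using s by (simp add: mult.commute)
    then have "l (2 ^ Suc k * s) \<le> 2 powr \<beta> * l (2 ^ k * s)" using dbl[of "2 ^ k * s"] by (simp add: mult.assoc)
    also have "\<dots> \<le> 2 powr \<beta> * ((2 ^ k) powr \<beta> * l s)" by (intro mult_left_mono Suc) auto
    also have "\<dots> = (2 ^ Suc k) powr \<beta> * l s" by (simp add: powr_mult)
    finally show ?case .
  qed simp
  have "l \<rho> \<le> 2 powr \<beta> * (\<rho> / s) powr \<beta> * l s" if s: "s0 \<le> s" "s \<le> \<rho>" for s \<rho>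
  proof -
    have s_pos: "s \<ge> 1" using s by (simp add: s0_def)
    have ex: "\<exists>k. \<rho> / s \<le> 2 ^ k" using real_arch_pow[of 2 "\<rho> / s"] by (auto intro: less_imp_le)
    \<comment> \<open>the number of doublings that lead from \<open>s\<close> past \<open>\<rho>\<close>, and not past \<open>2 \<rho>\<close>\<close>
    define k where "k = (LEAST k. \<rho> / s \<le> 2 ^ k)"
    have k: "\<rho> / s \<le> 2 ^ k" unfolding k_def by (rule LeastI_ex[OF ex])
    have k2: "2 ^ k \<le> 2 * (\<rho> / s)"
    proof (cases k)
      case 0
      then show ?thesis using s s_pos by simp
    next
      case (Suc j)
      then have "\<not> \<rho> / s \<le> 2 ^ j" using not_less_Least[of j "\<lambda>k. \<rho> / s \<le> 2 ^ k"] by (simp add: k_def)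
      then show ?thesis using Suc by simp
    qed
    have "\<rho> \<le> 2 ^ k * s" using k s_pos by (simp add: pos_divide_le_eq)
    then have "l \<rho> \<le> l (2 ^ k * s)"
      using s by (intro mono_onD[OF mono]) (auto simp: s0_def)
    also have "\<dots> \<le> (2 ^ k) powr \<beta> * l s" by (rule iter[OF s(1)])
    also have "\<dots> \<le> (2 * (\<rho> / s)) powr \<beta> * l s"
      using k2 \<beta> pos[OF s(1)] by (intro mult_right_mono powr_mono2) auto
    also have "(2 * (\<rho> / s)) powr \<beta> = 2 powr \<beta> * (\<rho> / s) powr \<beta>"
      by (rule powr_mult)
    finally show ?thesis .
  qed
  then show ?thesis using that[of s0] by (auto simp: s0_def)
qed

text \<open>Let \<open>M s = s\<^sup>\<alpha> / l s\<close>. Eventually \<open>t / 2 \<le> M (N t)\<close>, while \<open>M\<close> is bounded on bounded sets of positive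
  numbers, as \<open>l\<close> is bounded below by \<open>l a\<close>; hence \<open>N\<close> tends to infinity.\<close>

lemma asymptotic_inverse_large:
  assumes sv: "slowly_varying_on a l" and mono: "mono_on {a..} l" and \<alpha>: "\<alpha> > 0"
    and inv: "asymptotic_inverse_on a (\<lambda>s. s powr \<alpha> / l s) b N"
  shows "\<forall>\<^sub>F t in at_top. N t \<ge> R \<and> N t powr \<alpha> / l (N t) \<le> 2 * t"
proof -
  have la: "l a > 0" using sv by (simp add: slowly_varying_on_def)
  have Npos: "\<And>t. t \<ge> b \<Longrightarrow> N t > 0" and Na: "\<forall>\<^sub>F t in at_top. N t \<ge> a"
    and equiv: "(\<lambda>t. N t powr \<alpha> / l (N t)) \<sim>[at_top] (\<lambda>t. t)"
    using inv by (auto simp: asymptotic_inverse_on_def)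
  have lim: "((\<lambda>t. if N t powr \<alpha> / l (N t) = 0 \<and> t = 0 then 1 else (N t powr \<alpha> / l (N t)) / t) \<longlongrightarrow> 1) at_top"
    using equiv by (simp add: asymp_equiv_def)
  have "\<forall>\<^sub>F t in at_top. (if N t powr \<alpha> / l (N t) = 0 \<and> t = 0 then 1 else (N t powr \<alpha> / l (N t)) / t) < 2"
    "\<forall>\<^sub>F t in at_top. 1 / 2 < (if N t powr \<alpha> / l (N t) = 0 \<and> t = 0 then 1 else (N t powr \<alpha> / l (N t)) / t)"
    by (rule order_tendstoD[OF lim], simp)+
  then show ?thesis
    using Na eventually_ge_at_top[of b] eventually_gt_at_top[of 0]
      eventually_gt_at_top[of "2 * (\<bar>R\<bar> powr \<alpha> / l a)"]
  proof eventually_elim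
    case (elim t)
    have ratio: "(N t powr \<alpha> / l (N t)) / t < 2" "1 / 2 < (N t powr \<alpha> / l (N t)) / t" and t: "t > 0"
      using elim by simp_all
    have upper: "N t powr \<alpha> / l (N t) \<le> 2 * t"
      using ratio(1) unfolding pos_divide_less_eq[OF t] by simp
    have lower: "t / 2 \<le> N t powr \<alpha> / l (N t)"
      using ratio(2) unfolding pos_less_divide_eq[OF t] by simp
    have "N t \<ge> R"
    proof (rule ccontr)
      assume "\<not> N t \<ge> R"
      then have R: "N t \<le> \<bar>R\<bar>" by linarith
      have "l a \<le> l (N t)" using elim by (intro mono_onD[OF mono]) auto
      then have "N t powr \<alpha> / l (N t) \<le> \<bar>R\<bar> powr \<alpha> / l a"
        using R Npos[of t] elim la \<alpha> by (intro frac_le powr_mono2) auto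
      then show False using lower elim by simp
    qed
    then show ?case using upper by simp
  qed
qed

text \<open>The spectrum is that of \<open>A\<close>, whereas the resolvents are those of \<open>-A\<close>: the two differ by a
  reflection of the imaginary axis.\<close>

lemma imaginary_axis_resolvents:
  assumes "spectrum D A \<inter> range (\<lambda>s::real. \<i> * complex_of_real s) = {}"
  shows "bij_betw (\<lambda>x. (\<i> * complex_of_real s) *\<^sub>C x + A x) D UNIV"
    and "bounded_linear (inv_into D (\<lambda>x. (\<i> * complex_of_real s) *\<^sub>C x + A x))"
proof -
  define z where "z = \<i> * complex_of_real (- s)"
  let ?f = "\<lambda>x. z *\<^sub>C x - A x" and ?g = "\<lambda>x. (\<i> * complex_of_real s) *\<^sub>C x + A x"
  have "z \<in> resolvent_set D A"
    using assms unfolding spectrum_def z_def by blast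
  then have f: "bij_betw ?f D UNIV" and b: "bounded_linear (inv_into D ?f)"
    by (auto simp: resolvent_set_def bounded_clinear_def)
  have gf: "?g x = - ?f x" for x by (simp add: z_def)
  have "bij_betw (uminus \<circ> ?f) D UNIV"
    by (rule bij_betw_trans[OF f]) (simp add: bij_uminus)
  then show g: "bij_betw ?g D UNIV" by (simp add: gf o_def del: minus_diff_eq)
  have "inv_into D ?g y = inv_into D ?f (- y)" for y
  proof (rule inv_into_f_eq)
    show "inj_on ?g D" using g by (simp add: bij_betw_def)
    show "inv_into D ?f (- y) \<in> D" using f by (auto simp: bij_betw_def intro: inv_into_into)
    have "?f (inv_into D ?f (- y)) = - y" using f by (intro f_inv_into_f) (simp add: bij_betw_def)
    then show "?g (inv_into D ?f (- y)) = y" by (simp only: gf minus_minus)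
  qed
  then have "inv_into D ?g = (\<lambda>y. inv_into D ?f (- y))" by blast
  then show "bounded_linear (inv_into D ?g)"
    using bounded_linear_compose[OF b bounded_linear_minus[OF bounded_linear_ident]] by simp
qed

theorem corollary5p7:
  fixes T :: "real \<Rightarrow> 'a::complex_hilbert \<Rightarrow> 'a"
    and D :: "'a set"
    and A :: "'a \<Rightarrow> 'a"
    and \<alpha> a b :: real
    and l Minv :: "real \<Rightarrow> real"
  assumes "bounded_C0_semigroup T"
    and "is_generator T D (\<lambda>x. - A x)"
    and "spectrum D A \<inter> range (\<lambda>s::real. \<i> * complex_of_real s) = {}"
    and "\<alpha> > 0"
    and "slowly_varying_on a l"
    and "mono_on {a..} l"
    and "dB_symmetric_on a l"
    and "(\<lambda>s::real. onorm (inv_into D (\<lambda>x. (\<i> * complex_of_real s) *\<^sub>C x + A x)))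
           \<in> O[at_infinity](\<lambda>s. \<bar>s\<bar> powr \<alpha> / l \<bar>s\<bar>)"
    and "asymptotic_inverse_on a (\<lambda>s. s powr \<alpha> / l s) b Minv"
  shows "(\<lambda>t. onorm (T t \<circ> inv_into D A)) \<in> O[at_top](\<lambda>t. 1 / Minv t)"
proof -
  note semigroup = assms(1) and sv = assms(5) and mono = assms(6) and growth = assms(8) and inv = assms(9)
  obtain K0 where K0: "\<And>t. t \<ge> 0 \<Longrightarrow> onorm (T t) \<le> K0"
    using semigroup by (auto simp: bounded_C0_semigroup_def)
  define K where "K = max 1 K0"
  note resolvents = imaginary_axis_resolvents[OF assms(3)]
  interpret bounded_semigroup T D A K
  proof
    show clin: "bounded_clinear (T t)" if "t \<ge> 0" for t
      using semigroup that by (simp add: bounded_C0_semigroup_def C0_semigroup_def)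
    show "T 0 = id" "\<And>s t. s \<ge> 0 \<Longrightarrow> t \<ge> 0 \<Longrightarrow> T (s + t) = T s \<circ> T t"
      using semigroup by (auto simp: bounded_C0_semigroup_def C0_semigroup_def)
    show "norm (T t x) \<le> K * norm x" if "t \<ge> 0" for t x
    proof -
      have "norm (T t x) \<le> onorm (T t) * norm x"
        using clin[OF that] by (intro onorm) (simp add: bounded_clinear_def)
      also have "\<dots> \<le> K * norm x" using K0[OF that] by (intro mult_right_mono) (auto simp: K_def)
      finally show ?thesis .
    qed
    show "\<exists>B. \<forall>y. norm (inv_into D (\<lambda>x. (\<i> * complex_of_real s) *\<^sub>C x + A x) y) \<le> B * norm y" for s
      using onorm[OF resolvents(2)] by blast
  qed (use assms(2) resolvents(1) in \<open>auto simp: K_def\<close>)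

  define \<beta> where "\<beta> = \<alpha> / 2"
  have \<beta>: "\<beta> > 0" using assms(4) by (simp add: \<beta>_def)
  define M where "M s = s powr \<alpha> / l s" for s
  define m where "m s = onorm (res (\<i> * complex_of_real s))" for s
  have res_eq: "res (\<i> * complex_of_real s) = inv_into D (\<lambda>x. (\<i> * complex_of_real s) *\<^sub>C x + A x)" for s
    by (rule res_def)
  have res0: "res 0 = inv_into D A" by (simp add: res_def)
  have m: "norm (res (\<i> * complex_of_real s) y) \<le> m s * norm y" for s y
    unfolding m_def by (rule onorm) (simp add: res_linear)
  obtain m0 where m0: "m0 \<ge> 0" "\<And>y. norm (res 0 y) \<le> m0 * norm y"
    using res_bounded[of 0] by auto

  obtain s0 where s0: "s0 \<ge> 1" "s0 \<ge> a"
    and Potter: "\<And>s \<rho>. s0 \<le> s \<Longrightarrow> s \<le> \<rho> \<Longrightarrow> l \<rho> \<le> 2 powr \<beta> * (\<rho> / s) powr \<beta> * l s"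
    using slowly_varying_mono_Potter[OF sv mono \<beta>] by blast
  obtain c1 where c1: "c1 > 0" "\<forall>\<^sub>F s in at_infinity. norm (m s) \<le> c1 * norm (\<bar>s\<bar> powr \<alpha> / l \<bar>s\<bar>)"
    using growth unfolding res_eq[symmetric] m_def[symmetric] by (elim landau_o.bigE) blast
  then obtain s2 where s2: "\<And>s. norm s \<ge> s2 \<Longrightarrow> norm (m s) \<le> c1 * norm (\<bar>s\<bar> powr \<alpha> / l \<bar>s\<bar>)"
    unfolding eventually_at_infinity by blast
  define s1 where "s1 = max s0 s2"
  have s1: "s1 \<ge> 1" "s1 \<ge> a" "s1 \<ge> s0" "s1 \<ge> s2" using s0 by (auto simp: s1_def)
  have l_pos: "l s > 0" if "s \<ge> a" for s using sv that by (simp add: slowly_varying_on_def)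
  have M_pos: "M s > 0" if "s \<ge> s1" for s using that s1 l_pos[of s] by (simp add: M_def)
  have m_le_M: "m s \<le> c1 * M \<bar>s\<bar>" if "\<bar>s\<bar> \<ge> s1" for s
    using s2[of s] l_pos[of "\<bar>s\<bar>"] that s1 by (simp add: M_def)
  \<comment> \<open>Below \<open>\<rho>\<close> half of the exponent \<open>\<alpha>\<close> pays for the variation of \<open>l\<close> and the other half, \<open>\<beta>\<close>, survives.\<close>
  have M_below: "M s \<le> 2 powr \<beta> * ((s / \<rho>) powr \<beta> * M \<rho>)" if s: "s1 \<le> s" "s \<le> \<rho>" for s \<rho>
  proof -
    have pos: "s > 0" "\<rho> > 0" "l s > 0" "l \<rho> > 0" using s s1 l_pos by auto
    have "M s * l \<rho> \<le> M s * (2 powr \<beta> * (\<rho> / s) powr \<beta> * l s)"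
      using s s1 M_pos[of s] by (intro mult_left_mono Potter) auto
    also have "\<dots> = 2 powr \<beta> * (s powr \<beta> * s powr \<beta> * (\<rho> / s) powr \<beta>)"
      using pos by (simp add: M_def powr_add[symmetric] \<beta>_def)
    also have "s powr \<beta> * s powr \<beta> * (\<rho> / s) powr \<beta> = (s / \<rho>) powr \<beta> * (\<rho> powr \<beta> * \<rho> powr \<beta>)"
      using pos by (simp add: powr_divide)
    also have "\<rho> powr \<beta> * \<rho> powr \<beta> = M \<rho> * l \<rho>"
      using pos by (simp add: M_def powr_add[symmetric] \<beta>_def)
    finally have "M s * l \<rho> \<le> (2 powr \<beta> * ((s / \<rho>) powr \<beta> * M \<rho>)) * l \<rho>" by (simp add: mult_ac)
    then show ?thesis using pos by simp
  qed
  \<comment> \<open>Above \<open>\<rho>\<close> monotonicity of \<open>l\<close> suffices.\<close>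
  have M_above: "M s \<le> (s / \<rho>) powr \<alpha> * M \<rho>" if s: "s1 \<le> \<rho>" "\<rho> \<le> s" for s \<rho>
  proof -
    have pos: "s > 0" "\<rho> > 0" "l \<rho> > 0" using s s1 l_pos by auto
    have "M s \<le> s powr \<alpha> / l \<rho>"
      unfolding M_def using s s1 pos by (intro divide_left_mono mono_onD[OF mono] mult_pos_pos l_pos) auto
    also have "\<dots> = (s / \<rho>) powr \<alpha> * M \<rho>" using pos by (simp add: M_def powr_divide)
    finally show ?thesis .
  qed
  \<comment> \<open>By Potter's bound \<open>M\<close> stays above \<open>M s1 / 2\<^sup>\<beta>\<close>, so a multiple of \<open>M\<close> dominates the constant \<open>1\<close> too.\<close>
  define c3 where "c3 = max c1 (2 powr \<beta> / M s1)"
  have c3: "c3 > 0" "c3 \<ge> c1" "c3 \<ge> 2 powr \<beta> / M s1" using c1 by (auto simp: c3_def)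
  have max_le_M: "max 1 (m s) \<le> c3 * M \<bar>s\<bar>" if s: "s1 \<le> \<bar>s\<bar>" for s
  proof -
    have Ms: "M \<bar>s\<bar> > 0" "M s1 > 0" using M_pos s by auto
    have "M s1 \<le> 2 powr \<beta> * ((s1 / \<bar>s\<bar>) powr \<beta> * M \<bar>s\<bar>)" by (rule M_below) (use s in auto)
    also have "\<dots> \<le> 2 powr \<beta> * (1 * M \<bar>s\<bar>)"
      using s s1 \<beta> Ms by (intro mult_left_mono mult_right_mono powr_le1) auto
    finally have "1 \<le> 2 powr \<beta> / M s1 * M \<bar>s\<bar>" using Ms by (simp add: field_simps)
    also have "\<dots> \<le> c3 * M \<bar>s\<bar>" using c3 Ms by (intro mult_right_mono) auto
    finally have "1 \<le> c3 * M \<bar>s\<bar>" .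
    moreover have "m s \<le> c3 * M \<bar>s\<bar>"
      using order_trans[OF m_le_M[OF s] mult_right_mono[OF c3(2), of "M \<bar>s\<bar>"]] Ms by simp
    ultimately show ?thesis by simp
  qed
  obtain c where c: "c \<ge> 0" "\<And>s y. \<bar>s\<bar> \<le> s1 \<Longrightarrow> norm (res (\<i> * complex_of_real s) y) \<le> c * norm y"
    using imag_resolvent_bounded_on_compact[of s1] by blast
  have low: "m s \<le> c" if "\<bar>s\<bar> \<le> s1" for s
    unfolding m_def using c that by (intro onorm_bound) auto
  obtain p :: nat where p: "p \<ge> 1" "real p \<ge> \<alpha>"
    using real_arch_simple[of "max 1 \<alpha>"] by auto
  obtain n :: nat where n: "n \<ge> 1" "real n * \<beta> \<ge> 1"
  proof -
    obtain n :: nat where "real n \<ge> max 1 (1 / \<beta>)" using real_arch_simple by blast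
    then show ?thesis using that[of n] \<beta> by (auto simp: field_simps)
  qed
  define \<gamma> where "\<gamma> = c3 * 2 powr \<beta>"
  have \<gamma>: "\<gamma> > 0" "c3 \<le> \<gamma>" using c3 \<beta> ge_one_powr_ge_zero[of 2 \<beta>] by (auto simp: \<gamma>_def)
  define C where "C = c ^ n * m0 * K * s1 + (m0 + 1) * K + (real p * K + 1) ^ n * (m0 * K + 1)"
  have C: "C \<ge> 0" using c m0 K_ge_1 s1 by (auto simp: C_def)
  define E where "E = real (n * p) * K\<^sup>2 + 4 * K\<^sup>2 * (3 * real n * (1 + K) * (2 * \<gamma>)) ^ n * C"
  have E: "E \<ge> 0" using C K_ge_1 \<gamma> by (simp add: E_def)

  have "\<forall>\<^sub>F t in at_top. Minv t \<ge> s1 \<and> Minv t powr \<alpha> / l (Minv t) \<le> 2 * t"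
    by (rule asymptotic_inverse_large[OF sv mono assms(4) inv])
  then have "\<forall>\<^sub>F t in at_top. norm (onorm (T t \<circ> inv_into D A)) \<le> E * norm (1 / Minv t)"
    using eventually_gt_at_top[of 0]
  proof eventually_elim
    case (elim t)
    \<comment> \<open>The frequency at which the resolvent bound \<open>M \<rho>\<close> reaches the size of the time \<open>t\<close>.\<close>
    define \<rho> where "\<rho> = Minv t"
    define \<tau> where "\<tau> = \<gamma> * M \<rho>"
    have t: "t > 0" and \<rho>: "\<rho> \<ge> s1" "\<rho> > 0" and M\<rho>: "M \<rho> \<le> 2 * t" "M \<rho> > 0"
      using elim s1 M_pos[of \<rho>] by (auto simp: \<rho>_def M_def)
    have \<tau>: "\<tau> > 0" "\<tau> / t \<le> 2 * \<gamma>"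
      using M\<rho> \<gamma> t mult_left_mono[OF M\<rho>(1), of \<gamma>] by (auto simp: \<tau>_def pos_divide_le_eq mult_ac)
    have mid: "max 1 (m s) \<le> \<tau> * (\<bar>s\<bar> / \<rho>) powr \<beta>" if s: "s1 \<le> \<bar>s\<bar>" "\<bar>s\<bar> \<le> \<rho>" for s
      using order_trans[OF max_le_M[OF s(1)] mult_left_mono[OF M_below[OF s], of c3]] c3
      by (simp add: \<tau>_def \<gamma>_def mult_ac)
    have high: "m s \<le> \<tau> * (\<bar>s\<bar> / \<rho>) ^ p" if s: "\<rho> \<le> \<bar>s\<bar>" for s
    proof -
      have "m s \<le> c3 * M \<bar>s\<bar>" using max_le_M[of s] s \<rho> by simp
      also have "\<dots> \<le> \<gamma> * ((\<bar>s\<bar> / \<rho>) powr \<alpha> * M \<rho>)"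
        using M_pos[of "\<bar>s\<bar>"] s \<rho> \<gamma> by (intro mult_mono M_above) auto
      also have "\<dots> \<le> \<gamma> * ((\<bar>s\<bar> / \<rho>) powr real p * M \<rho>)"
        using s \<rho> p M\<rho> \<gamma> by (intro mult_left_mono mult_right_mono powr_mono) auto
      also have "(\<bar>s\<bar> / \<rho>) powr real p = (\<bar>s\<bar> / \<rho>) ^ p"
        using s \<rho> by (intro powr_realpow) auto
      finally show ?thesis by (simp add: \<tau>_def mult_ac)
    qed
    have "norm (T t (res 0 y)) \<le> E / \<rho> * norm y" for y
    proof -
      have "norm (T t (res 0 y)) \<le> (real (n * p) * K\<^sup>2 + 4 * K\<^sup>2 * (3 * real n * (1 + K) * (\<tau> / t)) ^ n * C) / \<rho> * norm y"
        unfolding C_def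
        by (rule T_inverse_bound[OF m m0(2,1) s1(1) \<rho>(1) n c(1) \<tau>(1) low mid high p(1) t])
      also have "\<dots> \<le> E / \<rho> * norm y"
        unfolding E_def using \<tau> \<rho> t C K_ge_1
        by (intro mult_right_mono divide_right_mono add_left_mono mult_left_mono power_mono) auto
      finally show ?thesis .
    qed
    then have "onorm (T t \<circ> inv_into D A) \<le> E / \<rho>"
      using E \<rho> by (intro onorm_bound) (auto simp: res0)
    moreover have "onorm (T t \<circ> inv_into D A) \<ge> 0"
      using t by (intro onorm_pos_le) (auto simp: res0[symmetric] o_def intro!: bounded_linear_compose[OF T_linear] res_linear)
    ultimately show ?case using \<rho> by (simp add: \<rho>_def)
  qed
  then show ?thesis by (rule bigoI)
qed

end
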